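(* There exists a finite tile set $T$ such that for every integer $k\ge 7$ there exists a nondecreasing temperature function $\tau_k:\mathbb{N}\to\mathbb{N}$ for which the size-dependent system $(T,\tau_k)$ self-assembles a $k\times k$ square.
   Context: Size-dependent two-handed tile assembly model. A tile type is a quadruple $(g_N,g_E,g_S,g_W)$ of glues from an alphabet $\Sigma$, each glue $g$ having a non-negative integer strength $\mathrm{str}(g)$. A tile is a unit square centered at a point of $\mathbb{Z}^2$ labeled by a tile type; two tiles are adjacent if their centers are at distance 1. An assembly is a partial map $\alpha:\mathbb{Z}^2\to T$ with finite domain $\mathrm{dom}(\alpha)$. Two adjacent tiles form a bond if the glues on their abutting edges are equal and of positive strength; the strength of the bond is that glue's strength. The bond graph of $\alpha$ has vertex set $\mathrm{dom}(\alpha)$ and an edge for each bond. A cut of an assembly is an edge cut of its bond graph (a partition of $\mathrm{dom}(\alpha)$ into two nonempty parts), and its strength is the total strength of bonds crossing it. A supertile $\tilde\alpha$ is the equivalence class of an assembly under translation; its size $|\tilde\alpha|$ is the number of tiles of an assembly in it. A size-dependent system is a pair $(T,\tau)$ with $T$ a finite tile set and $\tau:\mathbb{N}\to\mathbb{N}$ a nondecreasing temperature function. An assembly $\gamma$ is $\tau$-stable if every cut partitioning $\mathrm{dom}(\gamma)$ into parts $\alpha,\beta$ has strength at least $\tau(\min(|\alpha|,|\beta|))$. Two supertiles $\tilde\alpha,\tilde\beta$ can combine into $\tilde\gamma$ if there are disjoint assemblies $\alpha\in\tilde\alpha$, $\beta\in\tilde\beta$ with $\alpha\cup\beta=\gamma\in\tilde\gamma$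 and the cut separating $\mathrm{dom}(\alpha)$ from $\mathrm{dom}(\beta)$ has strength at least $\tau(\min(|\alpha|,|\beta|))$. A supertile $\tilde\gamma$ can break into $\tilde\alpha,\tilde\beta$ if there are disjoint assemblies $\alpha\in\tilde\alpha,\beta\in\tilde\beta$ with connected bond graphs, $\alpha\cup\beta=\gamma\in\tilde\gamma$, and the cut separating them has strength less than $\tau(\min(|\alpha|,|\beta|))$. A supertile is producible if it is a single tile of a type in $T$, a combination of two producible supertiles, or a result of a break of a producible supertile. A producible supertile is terminal if it can combine with no producible supertile and cannot break. The system self-assembles a shape $P\subseteq\mathbb{Z}^2$ if every terminal supertile has an assembly whose domain is exactly $P$ (and, implicitly, a terminal supertile exists). A $k\times k$ square is a set $\{x+1,\dots,x+k\}\times\{y+1,\dots,y+k\}$ for some integers $x,y$. *)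

theory Defs
  imports Main
begin

text \<open>Glues are drawn from the alphabet nat (any finite alphabet embeds into it);
  a strength function gstr assigns each glue a non-negative integer strength.
  A tile type is a quadruple (gN, gE, gS, gW) of glues.\<close>

type_synonym glue = nat
type_synonym tiletype = "glue \<times> glue \<times> glue \<times> glue"
type_synonym pos = "int \<times> int"
type_synonym assembly = "pos \<Rightarrow> tiletype option"

definition gN :: "tiletype \<Rightarrow> glue" where "gN t = fst t"
definition gE :: "tiletype \<Rightarrow> glue" where "gE t = fst (snd t)"
definition gS :: "tiletype \<Rightarrow> glue" where "gS t = fst (snd (snd t))"
definition gW :: "tiletype \<Rightarrow> glue" where "gW t = snd (snd (snd t))"

text \<open>Strength contributed by two abutting glues: equal glues of positive strength bond.\<close>
definition glue_bond :: "(glue \<Rightarrow> nat) \<Rightarrow> glue \<Rightarrow> glue \<Rightarrow> nat" where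
  "glue_bond gstr a b = (if a = b \<and> 0 < gstr a then gstr a else 0)"

text \<open>Strength of the bond between the tiles at positions p and q (0 if no bond).\<close>
definition bond_str :: "(glue \<Rightarrow> nat) \<Rightarrow> assembly \<Rightarrow> pos \<Rightarrow> pos \<Rightarrow> nat" where
  "bond_str gstr \<alpha> p q =
     (case (\<alpha> p, \<alpha> q) of
        (Some s, Some t) \<Rightarrow>
          (if q = (fst p + 1, snd p) then glue_bond gstr (gE s) (gW t)
           else if q = (fst p - 1, snd p) then glue_bond gstr (gW s) (gE t)
           else if q = (fst p, snd p + 1) then glue_bond gstr (gN s) (gS t)
           else if q = (fst p, snd p - 1) then glue_bond gstr (gS s) (gN t)
           else 0)
      | _ \<Rightarrow> 0)"

text \<open>Total strength of bonds crossing between position sets A and B.\<close>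
definition cut_str :: "(glue \<Rightarrow> nat) \<Rightarrow> assembly \<Rightarrow> pos set \<Rightarrow> pos set \<Rightarrow> nat" where
  "cut_str gstr \<alpha> A B = (\<Sum>(p, q) \<in> A \<times> B. bond_str gstr \<alpha> p q)"

text \<open>Connectedness of the bond graph.\<close>
definition bond_connected :: "(glue \<Rightarrow> nat) \<Rightarrow> assembly \<Rightarrow> bool" where
  "bond_connected gstr \<alpha> \<longleftrightarrow>
     (\<forall>p \<in> dom \<alpha>. \<forall>q \<in> dom \<alpha>.
        (p, q) \<in> {(u, v). u \<in> dom \<alpha> \<and> v \<in> dom \<alpha> \<and> 0 < bond_str gstr \<alpha> u v}\<^sup>*)"

definition translate :: "pos \<Rightarrow> assembly \<Rightarrow> assembly" where
  "translate v \<alpha> = (\<lambda>p. \<alpha> (fst p - fst v, snd p - snd v))"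

text \<open>Two assemblies represent the same supertile.\<close>
definition same_supertile :: "assembly \<Rightarrow> assembly \<Rightarrow> bool" where
  "same_supertile \<alpha> \<beta> \<longleftrightarrow> (\<exists>v. \<beta> = translate v \<alpha>)"

text \<open>Supertiles (represented by \<alpha>, \<beta>) can combine into (the supertile of) \<gamma>.\<close>
definition combines :: "(glue \<Rightarrow> nat) \<Rightarrow> (nat \<Rightarrow> nat) \<Rightarrow> assembly \<Rightarrow> assembly \<Rightarrow> assembly \<Rightarrow> bool" where
  "combines gstr \<tau> \<alpha> \<beta> \<gamma> \<longleftrightarrow>
     (\<exists>\<alpha>' \<beta>'. same_supertile \<alpha> \<alpha>' \<and> same_supertile \<beta> \<beta>' \<and>
        dom \<alpha>' \<inter> dom \<beta>' = {} \<and> same_supertile \<gamma> (\<alpha>' ++ \<beta>') \<and>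
        \<tau> (min (card (dom \<alpha>')) (card (dom \<beta>'))) \<le> cut_str gstr (\<alpha>' ++ \<beta>') (dom \<alpha>') (dom \<beta>'))"

text \<open>Supertile \<gamma> can break into supertiles \<alpha> and \<beta>.\<close>
definition breaks :: "(glue \<Rightarrow> nat) \<Rightarrow> (nat \<Rightarrow> nat) \<Rightarrow> assembly \<Rightarrow> assembly \<Rightarrow> assembly \<Rightarrow> bool" where
  "breaks gstr \<tau> \<gamma> \<alpha> \<beta> \<longleftrightarrow>
     (\<exists>\<alpha>' \<beta>'. same_supertile \<alpha> \<alpha>' \<and> same_supertile \<beta> \<beta>' \<and>
        dom \<alpha>' \<inter> dom \<beta>' = {} \<and> dom \<alpha>' \<noteq> {} \<and> dom \<beta>' \<noteq> {} \<and>
        bond_connected gstr \<alpha>' \<and> bond_connected gstr \<beta>' \<and>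
        same_supertile \<gamma> (\<alpha>' ++ \<beta>') \<and>
        cut_str gstr (\<alpha>' ++ \<beta>') (dom \<alpha>') (dom \<beta>') < \<tau> (min (card (dom \<alpha>')) (card (dom \<beta>'))))"

text \<open>Producible assemblies (closed under translation, so this describes producible supertiles).\<close>
inductive producible :: "tiletype set \<Rightarrow> (glue \<Rightarrow> nat) \<Rightarrow> (nat \<Rightarrow> nat) \<Rightarrow> assembly \<Rightarrow> bool"
  for T gstr \<tau> where
  single: "t \<in> T \<Longrightarrow> producible T gstr \<tau> (Map.empty((0, 0) \<mapsto> t))"
| transl: "producible T gstr \<tau> \<alpha> \<Longrightarrow> same_supertile \<alpha> \<alpha>' \<Longrightarrow> producible T gstr \<tau> \<alpha>'"
| comb: "producible T gstr \<tau> \<alpha> \<Longrightarrow> producible T gstr \<tau> \<beta> \<Longrightarrow> combines gstr \<tau> \<alpha> \<beta> \<gamma>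
          \<Longrightarrow> producible T gstr \<tau> \<gamma>"
| brk1: "producible T gstr \<tau> \<gamma> \<Longrightarrow> breaks gstr \<tau> \<gamma> \<alpha> \<beta> \<Longrightarrow> producible T gstr \<tau> \<alpha>"
| brk2: "producible T gstr \<tau> \<gamma> \<Longrightarrow> breaks gstr \<tau> \<gamma> \<alpha> \<beta> \<Longrightarrow> producible T gstr \<tau> \<beta>"

definition terminal :: "tiletype set \<Rightarrow> (glue \<Rightarrow> nat) \<Rightarrow> (nat \<Rightarrow> nat) \<Rightarrow> assembly \<Rightarrow> bool" where
  "terminal T gstr \<tau> \<alpha> \<longleftrightarrow>
     producible T gstr \<tau> \<alpha> \<and>
     (\<forall>\<beta> \<gamma>. producible T gstr \<tau> \<beta> \<longrightarrow> \<not> combines gstr \<tau> \<alpha> \<beta> \<gamma>) \<and>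
     (\<forall>\<beta>1 \<beta>2. \<not> breaks gstr \<tau> \<alpha> \<beta>1 \<beta>2)"

definition self_assembles :: "tiletype set \<Rightarrow> (glue \<Rightarrow> nat) \<Rightarrow> (nat \<Rightarrow> nat) \<Rightarrow> pos set \<Rightarrow> bool" where
  "self_assembles T gstr \<tau> P \<longleftrightarrow>
     (\<exists>\<alpha>. terminal T gstr \<tau> \<alpha>) \<and>
     (\<forall>\<alpha>. terminal T gstr \<tau> \<alpha> \<longrightarrow> (\<exists>\<alpha>'. same_supertile \<alpha> \<alpha>' \<and> dom \<alpha>' = P))"

definition is_square :: "nat \<Rightarrow> pos set \<Rightarrow> bool" where
  "is_square k P \<longleftrightarrow> (\<exists>x y. P = {x + 1 .. x + int k} \<times> {y + 1 .. y + int k})"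

end

(*
  Give the border edges of a square glues of strength 2 and the inner edges glues of strength 1,
  with a separate border glue for each of the four sides (nine tile types).  As tau 1 = 1, every
  finite connected assembly is producible, and an assembly showing a positive glue can grow; so an
  assembly is terminal iff all its exposed sides are null and no connected cut is weaker than tau.

  If a border tile misses one of its border bonds, then it can be torn off together with a neighbour
  at cost at most 4 < tau 2 (or, when this disconnects the rest, another cheap cut exists).  Hence
  border tiles form closed rings, a ring with shortest bottom row is a rectangle filled with inner
  tiles, and it is the whole assembly.

  The temperature follows the isoperimetric profile of the k x k square: a cut whose smaller part
  has n cells costs at least min k (ceil (2 sqrt n)) + 2, written below as a cardinality plus 2.
  A w x h rectangle with w < k and w <= h is cut in half at cost w + 2, which is below this profile;
  a rectangle with w, h >= k other than the square has a halving cut into two parts of more than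
  k^2 / 2 cells each, and such parts never arise in the square, so there tau may be large.
*)
theory Submission
  imports Defs
begin

text \<open>Cutting off a bonded pair of tiles costs the sum of their valencies minus twice their
  common bond. No valency exceeds 5 (two border bonds and one inner bond), so a cost above 4 makes
  every bond at most half the valency of each of its ends. An edge tile has sides of strength 2, 2,
  1 and a corner has 2, 2: a single border bond is too heavy for what remains (4 > 3 and 4 > 2), and
  so is a lone inner bond (2 > 1). Hence both border bonds are present. This argument does not
  control contacts between inner tiles and border tiles; wrong contacts of that kind are excluded
  only by the geometry of frames. The extra strength of the border also makes the competing cuts
  comparable. A straight cut of length w meets two border edges and costs w + 2; an r x c block in a
  corner costs r + c + 2. The common summand 2 cancels, and a halving cut into parts of at least n
  cells is too weak as soon as w < k and w < 2 sqrt n.\<close>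

section \<open>Bonds, translations and connected position sets\<close>

lemma bond_str_cong:
  "\<alpha> p = \<beta> p \<Longrightarrow> \<alpha> q = \<beta> q \<Longrightarrow> bond_str g \<alpha> p q = bond_str g \<beta> p q"
  by (simp add: bond_str_def)

lemma bond_str_sym: "bond_str g \<alpha> p q = bond_str g \<alpha> q p"
proof -
  obtain x y where p: "p = (x, y)" by (meson surj_pair)
  consider "q = (x + 1, y)" | "q = (x - 1, y)" | "q = (x, y + 1)" | "q = (x, y - 1)"
    | "q \<notin> {(x + 1, y), (x - 1, y), (x, y + 1), (x, y - 1)}" by blast
  then show ?thesis
  proof cases
    case 5
    obtain x' y' where q: "q = (x', y')" by (meson surj_pair)
    have "p \<notin> {(x' + 1, y'), (x' - 1, y'), (x', y' + 1), (x', y' - 1)}"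
      using 5 unfolding p q by auto
    then have "bond_str g \<alpha> q p = 0"
      unfolding q by (cases "\<alpha> (x', y')"; cases "\<alpha> p") (simp_all add: bond_str_def)
    moreover have "bond_str g \<alpha> p q = 0"
      using 5 unfolding p by (cases "\<alpha> (x, y)"; cases "\<alpha> q") (simp_all add: bond_str_def)
    ultimately show ?thesis by simp
  qed (auto simp: p bond_str_def glue_bond_def split: option.split)
qed

lemma bond_str_dom: "0 < bond_str g \<alpha> p q \<Longrightarrow> p \<in> dom \<alpha> \<and> q \<in> dom \<alpha>"
  by (auto simp: bond_str_def split: option.splits)

text \<open>\<open>translate\<close> acts on assemblies by pulling back. This is the matching
  forward map on positions, so that domains and the two sides of a cut move as images.\<close>

definition shift :: "pos \<Rightarrow> pos \<Rightarrow> pos" where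
  "shift v p = (fst p + fst v, snd p + snd v)"

lemma shift_inverse: "shift v (shift (- fst v, - snd v) p) = p"
  by (simp add: shift_def)

lemma inj_shift: "inj (shift v)"
  by (auto simp: inj_def shift_def prod_eq_iff)

lemma translate_shift [simp]: "translate v \<alpha> (shift v p) = \<alpha> p"
  by (simp add: translate_def shift_def)

lemma translate_zero: "translate (0, 0) \<alpha> = \<alpha>"
  by (simp add: translate_def)

lemma translate_single: "translate q (Map.empty((0, 0) \<mapsto> t)) = Map.empty(q \<mapsto> t)"
proof
  fix p
  have "(fst p - fst q, snd p - snd q) = (0, 0) \<longleftrightarrow> p = q" by (simp add: prod_eq_iff)
  then show "translate q (Map.empty((0, 0) \<mapsto> t)) p = (Map.empty(q \<mapsto> t)) p"
    unfolding translate_def by simp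
qed

lemma translate_translate:
  "translate v (translate u \<alpha>) = translate (fst u + fst v, snd u + snd v) \<alpha>"
  by (simp add: translate_def fun_eq_iff algebra_simps)

lemma dom_translate: "dom (translate v \<alpha>) = shift v ` dom \<alpha>"
proof
  show "dom (translate v \<alpha>) \<subseteq> shift v ` dom \<alpha>"
  proof
    fix p assume "p \<in> dom (translate v \<alpha>)"
    then have "(fst p - fst v, snd p - snd v) \<in> dom \<alpha>"
      by (auto simp: translate_def)
    moreover have "p = shift v (fst p - fst v, snd p - snd v)"
      by (simp add: shift_def)
    ultimately show "p \<in> shift v ` dom \<alpha>" by blast
  qed
  show "shift v ` dom \<alpha> \<subseteq> dom (translate v \<alpha>)"
    by (auto simp: dom_def)
qed

lemma ran_translate: "ran (translate v \<alpha>) = ran \<alpha>"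
proof -
  have "\<exists>p. translate v \<alpha> p = Some t" if "\<alpha> q = Some t" for q t
    using that translate_shift[of v \<alpha> q] by metis
  moreover have "\<exists>q. \<alpha> q = Some t" if "translate v \<alpha> p = Some t" for p t
    using that by (auto simp: translate_def)
  ultimately show ?thesis unfolding ran_def by blast
qed

lemma bond_str_translate:
  "bond_str g (translate v \<alpha>) (shift v p) (shift v q) = bond_str g \<alpha> p q"
proof -
  have *: "(shift v q = (fst (shift v p) + 1, snd (shift v p))) = (q = (fst p + 1, snd p))"
    "(shift v q = (fst (shift v p) - 1, snd (shift v p))) = (q = (fst p - 1, snd p))"
    "(shift v q = (fst (shift v p), snd (shift v p) + 1)) = (q = (fst p, snd p + 1))"
    "(shift v q = (fst (shift v p), snd (shift v p) - 1)) = (q = (fst p, snd p - 1))"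
    by (auto simp: shift_def prod_eq_iff)
  show ?thesis by (simp only: bond_str_def translate_shift *)
qed

lemma cut_str_translate:
  "cut_str g (translate v \<alpha>) (shift v ` A) (shift v ` B) = cut_str g \<alpha> A B"
proof -
  have "inj_on (map_prod (shift v) (shift v)) (A \<times> B)"
    using inj_shift[of v] by (auto simp: inj_on_def inj_def)
  moreover have "shift v ` A \<times> shift v ` B = map_prod (shift v) (shift v) ` (A \<times> B)"
    by auto
  ultimately show ?thesis
    unfolding cut_str_def
    by (simp add: sum.reindex case_prod_beta bond_str_translate)
qed

lemma same_supertile_refl: "same_supertile \<alpha> \<alpha>"
  unfolding same_supertile_def by (metis translate_zero)

lemma same_supertile_translate: "same_supertile \<alpha> (translate v \<alpha>)"
  unfolding same_supertile_def by blast

lemma same_supertile_sym: "same_supertile \<alpha> \<beta> \<Longrightarrow> same_supertile \<beta> \<alpha>"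
proof -
  assume "same_supertile \<alpha> \<beta>"
  then obtain v where "\<beta> = translate v \<alpha>" unfolding same_supertile_def by blast
  then have "\<alpha> = translate (- fst v, - snd v) \<beta>"
    by (simp add: translate_translate translate_zero)
  then show ?thesis unfolding same_supertile_def by blast
qed

lemma same_supertile_trans:
  "same_supertile \<alpha> \<beta> \<Longrightarrow> same_supertile \<beta> \<gamma> \<Longrightarrow> same_supertile \<alpha> \<gamma>"
  unfolding same_supertile_def by (metis translate_translate)

text \<open>Connectedness is taken relative to a position set inside a fixed assembly. The parts of
  a cut can thus be handled as plain sets, and restricted assemblies appear only when a break is
  formed.\<close>

definition links :: "(glue \<Rightarrow> nat) \<Rightarrow> assembly \<Rightarrow> pos set \<Rightarrow> pos rel" where
  "links g \<alpha> A = {(u, v). u \<in> A \<and> v \<in> A \<and> 0 < bond_str g \<alpha> u v}"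

definition linked :: "(glue \<Rightarrow> nat) \<Rightarrow> assembly \<Rightarrow> pos set \<Rightarrow> bool" where
  "linked g \<alpha> A \<longleftrightarrow> (\<forall>p\<in>A. \<forall>q\<in>A. (p, q) \<in> (links g \<alpha> A)\<^sup>*)"

lemma bond_connected_iff: "bond_connected g \<alpha> \<longleftrightarrow> linked g \<alpha> (dom \<alpha>)"
  unfolding bond_connected_def linked_def links_def ..

lemma linked_cong:
  assumes "\<And>p. p \<in> A \<Longrightarrow> \<alpha> p = \<beta> p"
  shows "linked g \<alpha> A = linked g \<beta> A"
proof -
  have "links g \<alpha> A = links g \<beta> A"
    unfolding links_def using bond_str_cong[of \<alpha> _ \<beta> _ g] assms by auto
  then show ?thesis unfolding linked_def by simp
qed

lemma linked_root:
  assumes "\<And>p. p \<in> A \<Longrightarrow> (p, a) \<in> (links g \<alpha> A)\<^sup>*"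
  shows "linked g \<alpha> A"
proof -
  have "sym (links g \<alpha> A)"
    unfolding sym_def links_def using bond_str_sym by auto
  then have "sym ((links g \<alpha> A)\<^sup>*)" by (rule sym_rtrancl)
  then show ?thesis unfolding linked_def using assms
    by (meson rtrancl_trans symD)
qed

lemma links_mono: "A \<subseteq> B \<Longrightarrow> links g \<alpha> A \<subseteq> links g \<alpha> B"
  unfolding links_def by blast

lemma linked_Un:
  assumes "linked g \<alpha> A" "linked g \<alpha> B" "p \<in> A" "q \<in> B" "0 < bond_str g \<alpha> p q"
  shows "linked g \<alpha> (A \<union> B)"
proof (rule linked_root[where a = p])
  fix r assume "r \<in> A \<union> B"
  have A: "(links g \<alpha> A)\<^sup>* \<subseteq> (links g \<alpha> (A \<union> B))\<^sup>*"
    and B: "(links g \<alpha> B)\<^sup>* \<subseteq> (links g \<alpha> (A \<union> B))\<^sup>*"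
    by (auto intro!: rtrancl_mono links_mono)
  have qp: "(q, p) \<in> (links g \<alpha> (A \<union> B))\<^sup>*"
    using assms(3-5) bond_str_sym[of g \<alpha> p q] by (auto simp: links_def)
  show "(r, p) \<in> (links g \<alpha> (A \<union> B))\<^sup>*"
  proof (cases "r \<in> A")
    case True
    then show ?thesis using assms(1,3) A unfolding linked_def by blast
  next
    case False
    then have "(r, q) \<in> (links g \<alpha> (A \<union> B))\<^sup>*"
      using \<open>r \<in> A \<union> B\<close> assms(2,4) B unfolding linked_def by blast
    then show ?thesis using qp by (rule rtrancl_trans)
  qed
qed

text \<open>On a path from \<open>A\<close> to the rest of \<open>D\<close> some step leaves
  \<open>A\<close>. This is the form in which connectedness of the whole domain is used
  below.\<close>

lemma linked_exit:
  assumes "linked g \<alpha> D" "A \<subseteq> D" "A \<noteq> {}" "A \<noteq> D"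
  obtains p q where "p \<in> A" "q \<in> D - A" "0 < bond_str g \<alpha> p q"
proof -
  obtain a b where ab: "a \<in> A" "b \<in> D" "b \<notin> A" using assms by blast
  then have "(a, b) \<in> (links g \<alpha> D)\<^sup>*" using assms unfolding linked_def by blast
  then have "b \<notin> A \<longrightarrow> (\<exists>p q. p \<in> A \<and> q \<in> D - A \<and> 0 < bond_str g \<alpha> p q)"
  proof (induction rule: rtrancl_induct)
    case base
    then show ?case using ab by simp
  next
    case (step y z)
    then have "y \<in> D" "z \<in> D" "0 < bond_str g \<alpha> y z" by (simp_all add: links_def)
    then show ?case using step.IH by blast
  qed
  then show ?thesis using ab that by blast
qed

lemma linked_translate:
  assumes "linked g \<alpha> A"
  shows "linked g (translate v \<alpha>) (shift v ` A)"
proof -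
  have *: "(shift v p, shift v q) \<in> (links g (translate v \<alpha>) (shift v ` A))\<^sup>*"
    if "(p, q) \<in> (links g \<alpha> A)\<^sup>*" for p q
    using that
  proof (induction rule: rtrancl_induct)
    case base
    then show ?case by simp
  next
    case (step y z)
    then have "(shift v y, shift v z) \<in> links g (translate v \<alpha>) (shift v ` A)"
      by (auto simp: links_def bond_str_translate)
    then show ?case using step by (meson rtrancl.rtrancl_into_rtrancl)
  qed
  then show ?thesis using assms unfolding linked_def by blast
qed

section \<open>Producible assemblies as finite connected assemblies\<close>

text \<open>For the temperatures used here this characterizes producibility:
  \<open>producible_wf\<close> gives one direction and \<open>linked_producible\<close> the
  other.\<close>

definition wf_asm :: "tiletype set \<Rightarrow> (glue \<Rightarrow> nat) \<Rightarrow> assembly \<Rightarrow> bool" where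
  "wf_asm T g \<alpha> \<longleftrightarrow>
     finite (dom \<alpha>) \<and> dom \<alpha> \<noteq> {} \<and> ran \<alpha> \<subseteq> T \<and> linked g \<alpha> (dom \<alpha>)"

lemma wf_asm_same_supertile: "wf_asm T g \<alpha> \<Longrightarrow> same_supertile \<alpha> \<beta> \<Longrightarrow> wf_asm T g \<beta>"
proof -
  assume *: "wf_asm T g \<alpha>" "same_supertile \<alpha> \<beta>"
  then obtain v where "\<beta> = translate v \<alpha>" unfolding same_supertile_def by blast
  then show ?thesis using *(1) linked_translate[of g \<alpha> "dom \<alpha>" v]
    unfolding wf_asm_def by (metis dom_translate ran_translate finite_imageI image_is_empty)
qed

lemma wf_asm_add:
  assumes "wf_asm T g \<alpha>" "wf_asm T g \<beta>" "dom \<alpha> \<inter> dom \<beta> = {}"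
    "0 < cut_str g (\<alpha> ++ \<beta>) (dom \<alpha>) (dom \<beta>)"
  shows "wf_asm T g (\<alpha> ++ \<beta>)"
proof -
  obtain p q where pq: "p \<in> dom \<alpha>" "q \<in> dom \<beta>" "0 < bond_str g (\<alpha> ++ \<beta>) p q"
    using assms(4) unfolding cut_str_def
    by (metis (no_types, lifting) SigmaE case_prod_conv gr0I less_irrefl sum.neutral)
  have "(\<alpha> ++ \<beta>) p = \<alpha> p" if "p \<in> dom \<alpha>" for p
    using that assms(3) by (metis disjoint_iff map_add_dom_app_simps(3))
  moreover have "(\<alpha> ++ \<beta>) p = \<beta> p" if "p \<in> dom \<beta>" for p
    using that by (rule map_add_dom_app_simps(1))
  ultimately have "linked g (\<alpha> ++ \<beta>) (dom \<alpha>)" "linked g (\<alpha> ++ \<beta>) (dom \<beta>)"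
    using assms(1,2) linked_cong[of "dom \<alpha>" "\<alpha> ++ \<beta>" \<alpha> g] linked_cong[of "dom \<beta>" "\<alpha> ++ \<beta>" \<beta> g]
    unfolding wf_asm_def by blast+
  then have "linked g (\<alpha> ++ \<beta>) (dom \<alpha> \<union> dom \<beta>)" using pq linked_Un by blast
  moreover have "ran (\<alpha> ++ \<beta>) \<subseteq> ran \<alpha> \<union> ran \<beta>"
    unfolding ran_def by auto
  ultimately show ?thesis using assms unfolding wf_asm_def by (auto simp: Un_commute)
qed

lemma wf_asm_break:
  assumes "wf_asm T g \<gamma>" "breaks g \<tau> \<gamma> \<alpha> \<beta>"
  shows "wf_asm T g \<alpha>" "wf_asm T g \<beta>"
proof -
  obtain \<alpha>' \<beta>' where *: "same_supertile \<alpha> \<alpha>'" "same_supertile \<beta> \<beta>'"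
    "dom \<alpha>' \<inter> dom \<beta>' = {}" "dom \<alpha>' \<noteq> {}" "dom \<beta>' \<noteq> {}"
    "bond_connected g \<alpha>'" "bond_connected g \<beta>'" "same_supertile \<gamma> (\<alpha>' ++ \<beta>')"
    using assms(2) unfolding breaks_def by blast
  have w: "wf_asm T g (\<alpha>' ++ \<beta>')" using wf_asm_same_supertile[OF assms(1) *(8)] .
  have "ran \<alpha>' \<subseteq> ran (\<alpha>' ++ \<beta>')" "ran \<beta>' \<subseteq> ran (\<alpha>' ++ \<beta>')"
    using *(3) by (auto simp: ran_map_add)
  then have "wf_asm T g \<alpha>'" "wf_asm T g \<beta>'"
    using w * unfolding wf_asm_def bond_connected_iff by auto
  then show "wf_asm T g \<alpha>" "wf_asm T g \<beta>"
    using * same_supertile_sym wf_asm_same_supertile by blast+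
qed

lemma wf_asm_single: "t \<in> T \<Longrightarrow> wf_asm T g (Map.empty(p \<mapsto> t))"
  unfolding wf_asm_def linked_def by auto

text \<open>A positive temperature forces a bond across every combination, so the union stays
  connected; the parts of a break are connected by definition.\<close>

lemma producible_wf:
  assumes "producible T g \<tau> \<alpha>" and "\<And>n. 1 \<le> \<tau> n"
  shows "wf_asm T g \<alpha>"
  using assms(1)
proof (induction rule: producible.induct)
  case (single t)
  then show ?case by (rule wf_asm_single)
next
  case (transl \<alpha> \<alpha>')
  then show ?case using wf_asm_same_supertile by blast
next
  case (comb \<alpha> \<beta> \<gamma>)
  then obtain \<alpha>' \<beta>' where *: "same_supertile \<alpha> \<alpha>'" "same_supertile \<beta> \<beta>'"
    "dom \<alpha>' \<inter> dom \<beta>' = {}" "same_supertile \<gamma> (\<alpha>' ++ \<beta>')"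
    "\<tau> (min (card (dom \<alpha>')) (card (dom \<beta>'))) \<le> cut_str g (\<alpha>' ++ \<beta>') (dom \<alpha>') (dom \<beta>')"
    unfolding combines_def by blast
  have "0 < cut_str g (\<alpha>' ++ \<beta>') (dom \<alpha>') (dom \<beta>')"
    using *(5) assms(2)[of "min (card (dom \<alpha>')) (card (dom \<beta>'))"] by linarith
  then have "wf_asm T g (\<alpha>' ++ \<beta>')"
    using wf_asm_add * comb.IH wf_asm_same_supertile by blast
  then show ?case using *(4) same_supertile_sym wf_asm_same_supertile by blast
next
  case (brk1 \<gamma> \<alpha> \<beta>)
  then show ?case using wf_asm_break by blast
next
  case (brk2 \<gamma> \<alpha> \<beta>)
  then show ?case using wf_asm_break by blast
qed

lemma bond_le_cut:
  assumes "finite A" "finite B" "p \<in> A" "q \<in> B"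
  shows "bond_str g \<alpha> p q \<le> cut_str g \<alpha> A B"
  using member_le_sum[of "(p, q)" "A \<times> B" "\<lambda>(p, q). bond_str g \<alpha> p q"] assms
  unfolding cut_str_def by auto

lemma combines_single:
  assumes "finite (dom \<alpha>)" "p \<in> dom \<alpha>" "q \<notin> dom \<alpha>"
    "0 < bond_str g (\<alpha>(q \<mapsto> t)) p q" "\<tau> 1 \<le> 1"
  shows "combines g \<tau> \<alpha> (Map.empty((0, 0) \<mapsto> t)) (\<alpha>(q \<mapsto> t))"
  unfolding combines_def
proof (intro exI conjI)
  let ?\<beta> = "Map.empty(q \<mapsto> t)"
  show "same_supertile (Map.empty((0, 0) \<mapsto> t)) ?\<beta>"
    using same_supertile_translate[of "Map.empty((0, 0) \<mapsto> t)" q] by (simp add: translate_single)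
  show "same_supertile \<alpha> \<alpha>" "same_supertile (\<alpha>(q \<mapsto> t)) (\<alpha> ++ ?\<beta>)"
    by (simp_all add: same_supertile_refl)
  show "dom \<alpha> \<inter> dom ?\<beta> = {}" using assms by auto
  have "1 \<le> card (dom \<alpha>)" using assms by (metis Suc_leI card_gt_0_iff empty_iff One_nat_def)
  then have "min (card (dom \<alpha>)) (card (dom ?\<beta>)) = 1" by simp
  moreover have "1 \<le> cut_str g (\<alpha> ++ ?\<beta>) (dom \<alpha>) (dom ?\<beta>)"
    using bond_le_cut[of "dom \<alpha>" "dom ?\<beta>" p q g "\<alpha> ++ ?\<beta>"] assms by auto
  ultimately show "\<tau> (min (card (dom \<alpha>)) (card (dom ?\<beta>)))
      \<le> cut_str g (\<alpha> ++ ?\<beta>) (dom \<alpha>) (dom ?\<beta>)"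
    using assms(5) by simp
qed

text \<open>A largest producible nonempty part must be the whole assembly. Otherwise a bond leaves
  it, and the tile behind that bond can be attached alone, because a bond of strength 1 suffices
  when the smaller side is a single tile.\<close>

lemma linked_producible:
  assumes "wf_asm T g \<alpha>" "\<tau> 1 \<le> 1"
  shows "producible T g \<tau> \<alpha>"
proof -
  let ?P = "\<lambda>A. A \<subseteq> dom \<alpha> \<and> A \<noteq> {} \<and> producible T g \<tau> (\<alpha> |` A)"
  have fin: "finite (dom \<alpha>)" using assms unfolding wf_asm_def by blast
  obtain p t where p: "\<alpha> p = Some t" using assms unfolding wf_asm_def by blast
  then have "t \<in> T" using assms(1) ranI[of \<alpha> p t] unfolding wf_asm_def by blast
  then have "producible T g \<tau> (Map.empty(p \<mapsto> t))"
    using producible.transl[OF producible.single same_supertile_translate, of t T g \<tau> p]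
    by (simp add: translate_single)
  moreover have "\<alpha> |` {p} = Map.empty(p \<mapsto> t)"
    using p by (intro ext) (simp add: restrict_map_def)
  ultimately have "?P {p}" using p by auto
  then obtain A where A: "?P A" and max: "\<And>B. ?P B \<Longrightarrow> card B \<le> card A"
    using ex_has_greatest_nat[of ?P "{p}" card "Suc (card (dom \<alpha>))"] card_mono[OF fin]
    by (metis (no_types, lifting) le_imp_less_Suc)
  have "A = dom \<alpha>"
  proof (rule ccontr)
    assume "A \<noteq> dom \<alpha>"
    then obtain u v where uv: "u \<in> A" "v \<in> dom \<alpha> - A" "0 < bond_str g \<alpha> u v"
      using linked_exit[of g \<alpha> "dom \<alpha>" A] A assms unfolding wf_asm_def by blast
    then obtain s where s: "\<alpha> v = Some s" by blast
    have eq: "(\<alpha> |` A)(v \<mapsto> s) = \<alpha> |` insert v A"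
      using s by (intro ext) (simp add: restrict_map_def)
    have "0 < bond_str g ((\<alpha> |` A)(v \<mapsto> s)) u v"
      unfolding eq using uv bond_str_cong[of "\<alpha> |` insert v A" u \<alpha> v g] by simp
    then have "combines g \<tau> (\<alpha> |` A) (Map.empty((0, 0) \<mapsto> s)) (\<alpha> |` insert v A)"
      using combines_single[of "\<alpha> |` A" u v g s \<tau>] uv A fin assms(2) eq by auto
    moreover have "s \<in> T" using s assms(1) ranI[of \<alpha> v s] unfolding wf_asm_def by blast
    ultimately have "producible T g \<tau> (\<alpha> |` insert v A)"
      using A producible.comb producible.single by blast
    then have "?P (insert v A)" using A uv by auto
    then have "card (insert v A) \<le> card A" by (rule max)
    moreover have "finite A" using A fin finite_subset by blast
    ultimately show False using uv by simp
  qed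
  moreover have "\<alpha> |` dom \<alpha> = \<alpha>"
    by (metis (no_types, lifting) domIff ext restrict_in restrict_out)
  ultimately show ?thesis using A by simp
qed

text \<open>Expresses a break as a partition of the domain of one representative, which is what the
  cut arguments below supply.\<close>

lemma breaksI:
  assumes "same_supertile \<gamma> \<rho>" "dom \<rho> = A \<union> B" "A \<inter> B = {}" "A \<noteq> {}" "B \<noteq> {}"
    "linked g \<rho> A" "linked g \<rho> B" "cut_str g \<rho> A B < \<tau> (min (card A) (card B))"
  shows "breaks g \<tau> \<gamma> (\<rho> |` A) (\<rho> |` B)"
proof -
  have d: "dom (\<rho> |` A) = A" "dom (\<rho> |` B) = B" using assms(2) by auto
  have j: "\<rho> |` A ++ \<rho> |` B = \<rho>"
  proof
    fix p
    show "(\<rho> |` A ++ \<rho> |` B) p = \<rho> p"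
      using assms(2) by (cases "p \<in> A"; cases "p \<in> B"; cases "\<rho> p")
        (auto simp: map_add_def restrict_map_def)
  qed
  have "linked g (\<rho> |` A) A" "linked g (\<rho> |` B) B"
    using assms linked_cong[of A "\<rho> |` A" \<rho>] linked_cong[of B "\<rho> |` B" \<rho>] by auto
  then show ?thesis
    unfolding breaks_def bond_connected_iff
    using assms d j same_supertile_refl by metis
qed

section \<open>The nine tile types and weighted degrees\<close>

text \<open>The first index says whether the tile sits in the left column (1), the right column (2) or in
  between (3); the second one does the same for the bottom row, the top row and the rows in between.
  The indices double as the glues of the vertical and horizontal bonds, 0 being the null glue.\<close>
definition tile :: "nat \<Rightarrow> nat \<Rightarrow> tiletype" where
  "tile i j = (if j = 2 then 0 else i, if i = 2 then 0 else j,
               if j = 1 then 0 else i, if i = 1 then 0 else j)"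

definition tiles :: "tiletype set" where
  "tiles = (\<lambda>(i, j). tile i j) ` ({1, 2, 3} \<times> {1, 2, 3})"

text \<open>North and south sides never abut east or west sides, so reusing the glues 1 and 2 for
  columns and for rows creates no unwanted bonds.\<close>

definition gs :: "glue \<Rightarrow> nat" where
  "gs g = (if g = 1 \<or> g = 2 then 2 else if g = 3 then 1 else 0)"

text \<open>The index range is part of the predicate because it yields both the case distinctions
  and the positive strength of the glues \<open>i\<close> and \<open>j\<close>.\<close>

definition has :: "assembly \<Rightarrow> pos \<Rightarrow> nat \<Rightarrow> nat \<Rightarrow> bool" where
  "has \<alpha> p i j \<longleftrightarrow> \<alpha> p = Some (tile i j) \<and> i \<in> {1, 2, 3} \<and> j \<in> {1, 2, 3}"

lemma finite_tiles: "finite tiles"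
  unfolding tiles_def by simp

lemma tile_sides:
  "gN (tile i j) = (if j = 2 then 0 else i)" "gE (tile i j) = (if i = 2 then 0 else j)"
  "gS (tile i j) = (if j = 1 then 0 else i)" "gW (tile i j) = (if i = 1 then 0 else j)"
  by (simp_all add: tile_def gN_def gE_def gS_def gW_def)

lemma tile_in_tiles: "i \<in> {1, 2, 3} \<Longrightarrow> j \<in> {1, 2, 3} \<Longrightarrow> tile i j \<in> tiles"
  unfolding tiles_def by blast

lemma tile_inject:
  "tile i j = tile i' j' \<Longrightarrow> i \<in> {1, 2, 3} \<Longrightarrow> j \<in> {1, 2, 3} \<Longrightarrow> i' \<in> {1, 2, 3}
    \<Longrightarrow> j' \<in> {1, 2, 3} \<Longrightarrow> i = i' \<and> j = j'"
  by (auto simp: tile_def split: if_splits)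

lemma has_inject: "has \<alpha> p i j \<Longrightarrow> has \<alpha> p i' j' \<Longrightarrow> i = i' \<and> j = j'"
  unfolding has_def by (metis option.inject tile_inject)

lemma has_dom: "has \<alpha> p i j \<Longrightarrow> p \<in> dom \<alpha>"
  unfolding has_def by auto

lemma glue_bond_gs: "glue_bond gs a b = (if a = b then gs a else 0)"
  by (simp add: glue_bond_def)

lemma bond_right:
  assumes "has \<alpha> (x, y) i j" "has \<alpha> (x + 1, y) i' j'"
  shows "bond_str gs \<alpha> (x, y) (x + 1, y) = (if i \<noteq> 2 \<and> i' \<noteq> 1 \<and> j = j' then gs j else 0)"
proof -
  have "bond_str gs \<alpha> (x, y) (x + 1, y) = glue_bond gs (gE (tile i j)) (gW (tile i' j'))"
    using assms unfolding has_def bond_str_def by simp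
  then show ?thesis using assms unfolding has_def glue_bond_gs tile_sides
    by (auto simp: gs_def)
qed

lemma bond_up:
  assumes "has \<alpha> (x, y) i j" "has \<alpha> (x, y + 1) i' j'"
  shows "bond_str gs \<alpha> (x, y) (x, y + 1) = (if j \<noteq> 2 \<and> j' \<noteq> 1 \<and> i = i' then gs i else 0)"
proof -
  have "bond_str gs \<alpha> (x, y) (x, y + 1) = glue_bond gs (gN (tile i j)) (gS (tile i' j'))"
    using assms unfolding has_def bond_str_def by simp
  then show ?thesis using assms unfolding has_def glue_bond_gs tile_sides
    by (auto simp: gs_def)
qed

definition nbrs :: "pos \<Rightarrow> pos set" where
  "nbrs p = {(fst p + 1, snd p), (fst p - 1, snd p), (fst p, snd p + 1), (fst p, snd p - 1)}"

lemma bond_nbrs: "0 < bond_str g \<alpha> p q \<Longrightarrow> q \<in> nbrs p"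
  unfolding bond_str_def nbrs_def by (auto split: option.splits if_splits)

lemma nbrs_odd: "q \<in> nbrs p \<Longrightarrow> odd (fst p + snd p + fst q + snd q)"
  unfolding nbrs_def by auto

lemma nbrs_sym: "q \<in> nbrs p \<Longrightarrow> p \<in> nbrs q"
  unfolding nbrs_def by (cases p; cases q) auto

text \<open>The grid is bipartite: the parity of the coordinate sum changes along every edge, so
  there are no triangles.\<close>

lemma nbrs_triangle: "q \<in> nbrs p \<Longrightarrow> r \<in> nbrs p \<Longrightarrow> r \<notin> nbrs q"
  by (drule nbrs_odd, drule nbrs_odd, rule notI, drule nbrs_odd) presburger

lemma finite_nbrs: "finite (nbrs p)"
  unfolding nbrs_def by simp

definition valency :: "assembly \<Rightarrow> pos \<Rightarrow> nat" where
  "valency \<alpha> p = (\<Sum>q\<in>nbrs p. bond_str gs \<alpha> p q)"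

lemma sum_bond_le_valency: "finite A \<Longrightarrow> (\<Sum>q\<in>A. bond_str gs \<alpha> p q) \<le> valency \<alpha> p"
proof -
  assume "finite A"
  have "(\<Sum>q\<in>A. bond_str gs \<alpha> p q) = (\<Sum>q\<in>A \<inter> nbrs p. bond_str gs \<alpha> p q)"
    using \<open>finite A\<close> bond_nbrs[of gs \<alpha> p] by (intro sum.mono_neutral_right) auto
  also have "\<dots> \<le> valency \<alpha> p"
    unfolding valency_def by (intro sum_mono2) (auto simp: finite_nbrs)
  finally show ?thesis .
qed

lemma valency_eq:
  "valency \<alpha> (x, y) = bond_str gs \<alpha> (x, y) (x + 1, y) + bond_str gs \<alpha> (x, y) (x - 1, y)
     + bond_str gs \<alpha> (x, y) (x, y + 1) + bond_str gs \<alpha> (x, y) (x, y - 1)"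
  unfolding valency_def nbrs_def by (simp add: add.assoc)

text \<open>The bond between \<open>a\<close> and \<open>b\<close> is counted in both valencies but
  does not cross the cut.\<close>

lemma domino_cut:
  assumes "finite D" "a \<in> D" "b \<in> D" "a \<noteq> b"
  shows "cut_str gs \<alpha> {a, b} (D - {a, b}) + 2 * bond_str gs \<alpha> a b \<le> valency \<alpha> a + valency \<alpha> b"
proof -
  let ?B = "D - {a, b}"
  have "cut_str gs \<alpha> {a, b} ?B = (\<Sum>q\<in>?B. bond_str gs \<alpha> a q) + (\<Sum>q\<in>?B. bond_str gs \<alpha> b q)"
    using assms unfolding cut_str_def by (simp add: sum.cartesian_product[symmetric])
  moreover have "(\<Sum>q\<in>?B. bond_str gs \<alpha> a q) + bond_str gs \<alpha> a b \<le> valency \<alpha> a"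
    using sum_bond_le_valency[of "insert b ?B" \<alpha> a] assms(1) by simp
  moreover have "(\<Sum>q\<in>?B. bond_str gs \<alpha> b q) + bond_str gs \<alpha> a b \<le> valency \<alpha> b"
    using sum_bond_le_valency[of "insert a ?B" \<alpha> b] assms(1) bond_str_sym[of gs \<alpha> a b] by simp
  ultimately show ?thesis by simp
qed

section \<open>Local structure: cheap cuts and border bonds\<close>

text \<open>Collects what the shape argument takes from terminality: no single tile can attach, and
  no cheap break exists. The bound 5 is a lower bound of \<open>temp k n\<close> for all
  \<open>3 \<le> k\<close> and \<open>2 \<le> n\<close>, so the locale does not mention
  \<open>k\<close>, and the rectangular shape is derived for all \<open>k\<close> at once.\<close>

locale closed_asm =
  fixes \<alpha> :: assembly
  assumes wf: "wf_asm tiles gs \<alpha>"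
    and closed: "\<And>p q t. \<lbrakk>p \<in> dom \<alpha>; t \<in> tiles; 0 < bond_str gs (\<alpha>(q \<mapsto> t)) p q\<rbrakk> \<Longrightarrow> q \<in> dom \<alpha>"
    and cut: "\<And>A B. \<lbrakk>A \<union> B = dom \<alpha>; A \<inter> B = {}; 2 \<le> card A; 2 \<le> card B; linked gs \<alpha> A; linked gs \<alpha> B\<rbrakk>
      \<Longrightarrow> 5 \<le> cut_str gs \<alpha> A B"
begin

abbreviation bond :: "pos \<Rightarrow> pos \<Rightarrow> nat" where
  "bond \<equiv> bond_str gs \<alpha>"

lemma fin: "finite (dom \<alpha>)" and conn: "linked gs \<alpha> (dom \<alpha>)" and ne: "dom \<alpha> \<noteq> {}"
  using wf unfolding wf_asm_def by auto

lemma dom_has: "p \<in> dom \<alpha> \<Longrightarrow> \<exists>i j. has \<alpha> p i j"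
proof -
  assume "p \<in> dom \<alpha>"
  then obtain t where t: "\<alpha> p = Some t" by blast
  then have "t \<in> tiles" using wf ranI[of \<alpha> p t] unfolding wf_asm_def by blast
  then show ?thesis using t unfolding tiles_def has_def by auto
qed

lemma closed_side:
  assumes "has \<alpha> (x, y) i j"
  shows "i \<noteq> 2 \<Longrightarrow> (x + 1, y) \<in> dom \<alpha>" "i \<noteq> 1 \<Longrightarrow> (x - 1, y) \<in> dom \<alpha>"
    "j \<noteq> 2 \<Longrightarrow> (x, y + 1) \<in> dom \<alpha>" "j \<noteq> 1 \<Longrightarrow> (x, y - 1) \<in> dom \<alpha>"
proof -
  have ij: "i \<in> {1, 2, 3}" "j \<in> {1, 2, 3}" using assms unfolding has_def by auto
  have d: "(x, y) \<in> dom \<alpha>" using assms by (rule has_dom)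
  let ?v = "\<lambda>p i j. \<alpha>(p \<mapsto> tile i j)"
  have h: "has (?v p i' j') (x, y) i j" if "p \<noteq> (x, y)" for p i' j'
    using that assms unfolding has_def by simp
  have h': "has (?v p i' j') p i' j'" if "i' \<in> {1, 2, 3}" "j' \<in> {1, 2, 3}" for p i' j'
    using that unfolding has_def by simp
  have pos: "0 < gs i" "0 < gs j" using ij by (auto simp: gs_def)
  \<comment> \<open>Index 3 leaves both opposite sides open, so \<open>tile 3 j\<close> offers the
    glue \<open>j\<close> to the west and would attach here. The other three directions are
    analogous.\<close>
  show "(x + 1, y) \<in> dom \<alpha>" if "i \<noteq> 2"
  proof (rule closed[OF d tile_in_tiles[of 3 j]])
    show "0 < bond_str gs (?v (x + 1, y) 3 j) (x, y) (x + 1, y)"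
      using bond_right[OF h h', of 3 j] ij that pos by simp
  qed (use ij in auto)
  show "(x - 1, y) \<in> dom \<alpha>" if "i \<noteq> 1"
  proof (rule closed[OF d tile_in_tiles[of 3 j]])
    have "0 < bond_str gs (?v (x - 1, y) 3 j) (x - 1, y) (x, y)"
      using bond_right[of _ "x - 1" y 3 j i j] h[of "(x - 1, y)" 3 j] h'[of 3 j "(x - 1, y)"] ij that pos
      by simp
    then show "0 < bond_str gs (?v (x - 1, y) 3 j) (x, y) (x - 1, y)"
      by (simp add: bond_str_sym[of gs _ "(x, y)"])
  qed (use ij in auto)
  show "(x, y + 1) \<in> dom \<alpha>" if "j \<noteq> 2"
  proof (rule closed[OF d tile_in_tiles[of i 3]])
    show "0 < bond_str gs (?v (x, y + 1) i 3) (x, y) (x, y + 1)"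
      using bond_up[OF h h', of i 3] ij that pos by simp
  qed (use ij in auto)
  show "(x, y - 1) \<in> dom \<alpha>" if "j \<noteq> 1"
  proof (rule closed[OF d tile_in_tiles[of i 3]])
    have "0 < bond_str gs (?v (x, y - 1) i 3) (x, y - 1) (x, y)"
      using bond_up[of _ x "y - 1" i 3 i j] h[of "(x, y - 1)" i 3] h'[of i 3 "(x, y - 1)"] ij that pos
      by simp
    then show "0 < bond_str gs (?v (x, y - 1) i 3) (x, y) (x, y - 1)"
      by (simp add: bond_str_sym[of gs _ "(x, y)"])
  qed (use ij in auto)
qed

text \<open>No index closes two opposite sides, so there is a horizontal and a vertical neighbour,
  and \<open>b\<close> can be only one of them.\<close>

lemma two_neighbours:
  assumes "a \<in> dom \<alpha>"
  obtains p where "p \<in> dom \<alpha>" "p \<in> nbrs a" "p \<noteq> b"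
proof -
  obtain i j where h: "has \<alpha> (fst a, snd a) i j" using dom_has[OF assms] by auto
  let ?x = "fst a" and ?y = "snd a"
  have "(?x + 1, ?y) \<in> dom \<alpha> \<or> (?x - 1, ?y) \<in> dom \<alpha>"
    using closed_side(1,2)[OF h] by (cases "i = 2") simp_all
  moreover have "(?x, ?y + 1) \<in> dom \<alpha> \<or> (?x, ?y - 1) \<in> dom \<alpha>"
    using closed_side(3,4)[OF h] by (cases "j = 2") simp_all
  ultimately obtain p q where "p \<in> {(?x + 1, ?y), (?x - 1, ?y)}" "q \<in> {(?x, ?y + 1), (?x, ?y - 1)}"
    "p \<in> dom \<alpha>" "q \<in> dom \<alpha>" by blast
  moreover from this have "p \<noteq> q" "p \<in> nbrs a" "q \<in> nbrs a" unfolding nbrs_def by auto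
  ultimately show ?thesis using that[of p] that[of q] by blast
qed

text \<open>Adjacent tiles need not match, so a bond is known only up to an alternative: it is
  absent or has the full strength of the glue on that side.\<close>

lemma bond_cases:
  assumes "has \<alpha> (x, y) i j"
  shows "bond (x, y) (x + 1, y) \<in> {0, if i = 2 then 0 else gs j}"
    "bond (x, y) (x - 1, y) \<in> {0, if i = 1 then 0 else gs j}"
    "bond (x, y) (x, y + 1) \<in> {0, if j = 2 then 0 else gs i}"
    "bond (x, y) (x, y - 1) \<in> {0, if j = 1 then 0 else gs i}"
proof -
  have z: "bond (x, y) q = 0" if "q \<notin> dom \<alpha>" for q
    using that bond_str_dom[of gs \<alpha> "(x, y)" q] by auto
  show "bond (x, y) (x + 1, y) \<in> {0, if i = 2 then 0 else gs j}"
    using bond_right[OF assms] dom_has[of "(x + 1, y)"] z by (cases "(x + 1, y) \<in> dom \<alpha>") auto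
  show "bond (x, y) (x, y + 1) \<in> {0, if j = 2 then 0 else gs i}"
    using bond_up[OF assms] dom_has[of "(x, y + 1)"] z by (cases "(x, y + 1) \<in> dom \<alpha>") auto
  show "bond (x, y) (x - 1, y) \<in> {0, if i = 1 then 0 else gs j}"
    using bond_right[of \<alpha> "x - 1" y _ _ i j] assms dom_has[of "(x - 1, y)"] z
      bond_str_sym[of gs \<alpha> "(x, y)" "(x - 1, y)"]
    by (cases "(x - 1, y) \<in> dom \<alpha>") auto
  show "bond (x, y) (x, y - 1) \<in> {0, if j = 1 then 0 else gs i}"
    using bond_up[of \<alpha> x "y - 1" _ _ i j] assms dom_has[of "(x, y - 1)"] z
      bond_str_sym[of gs \<alpha> "(x, y)" "(x, y - 1)"]
    by (cases "(x, y - 1) \<in> dom \<alpha>") auto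
qed

end

text \<open>\<open>T\<close> is the component of \<open>S\<close> inside \<open>B\<close>, obtained
  as a linked superset of greatest cardinality.\<close>

lemma max_linked:
  assumes "finite B" "S \<subseteq> B" "S \<noteq> {}" "linked g \<alpha> S"
  obtains T where "S \<subseteq> T" "T \<subseteq> B" "linked g \<alpha> T"
    "\<And>u v. u \<in> T \<Longrightarrow> v \<in> B - T \<Longrightarrow> bond_str g \<alpha> u v = 0"
proof -
  let ?P = "\<lambda>T. S \<subseteq> T \<and> T \<subseteq> B \<and> linked g \<alpha> T"
  have "?P S" "\<forall>T. ?P T \<longrightarrow> card T < Suc (card B)"
    using assms card_mono[OF assms(1)] by (auto simp: less_Suc_eq_le)
  then obtain T where T: "?P T" and max: "\<And>U. ?P U \<Longrightarrow> card U \<le> card T"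
    using ex_has_greatest_nat[of ?P S card "Suc (card B)"] by blast
  have "bond_str g \<alpha> u v = 0" if "u \<in> T" "v \<in> B - T" for u v
  proof (rule ccontr)
    assume "bond_str g \<alpha> u v \<noteq> 0"
    moreover have "linked g \<alpha> {v}" unfolding linked_def by simp
    ultimately have "linked g \<alpha> (T \<union> {v})" using linked_Un[of g \<alpha> T "{v}" u v] T that by simp
    then have "?P (insert v T)" using T that by auto
    then have "card (insert v T) \<le> card T" by (rule max)
    moreover have "finite T" using T assms(1) finite_subset by blast
    ultimately show False using that by simp
  qed
  then show ?thesis using that T by blast
qed

lemma linked_star:
  assumes "\<And>x. x \<in> X \<Longrightarrow> 0 < bond_str g \<alpha> x a"
  shows "linked g \<alpha> (insert a X)"
proof (rule linked_root[where a = a])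
  fix p assume "p \<in> insert a X"
  then consider "p = a" | "(p, a) \<in> links g \<alpha> (insert a X)"
    using assms[of p] by (auto simp: links_def)
  then show "(p, a) \<in> (links g \<alpha> (insert a X))\<^sup>*" by cases auto
qed

lemma cut_str_mono: "finite C \<Longrightarrow> finite D \<Longrightarrow> A \<subseteq> C \<Longrightarrow> B \<subseteq> D \<Longrightarrow> cut_str g \<alpha> A B \<le> cut_str g \<alpha> C D"
  unfolding cut_str_def by (intro sum_mono2) auto

lemma cut_str_restrict:
  assumes "finite A" "finite B" "C \<subseteq> A \<times> B"
    "\<And>p q. p \<in> A \<Longrightarrow> q \<in> B \<Longrightarrow> (p, q) \<notin> C \<Longrightarrow> bond_str g \<alpha> p q = 0"
  shows "cut_str g \<alpha> A B = (\<Sum>(p, q)\<in>C. bond_str g \<alpha> p q)"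
  unfolding cut_str_def
proof (rule sum.mono_neutral_right)
  show "\<forall>r\<in>A \<times> B - C. (case r of (p, q) \<Rightarrow> bond_str g \<alpha> p q) = 0"
  proof
    fix r assume r: "r \<in> A \<times> B - C"
    obtain p q where "r = (p, q)" by (rule prod.exhaust)
    then show "(case r of (p, q) \<Rightarrow> bond_str g \<alpha> p q) = 0" using r assms(4)[of p q] by simp
  qed
qed (use assms in auto)

lemma cut_str_sym: "cut_str g \<alpha> A B = cut_str g \<alpha> B A"
  unfolding cut_str_def using bond_str_sym[of g \<alpha>]
  by (intro sum.reindex_bij_witness[where i = prod.swap and j = prod.swap]) auto

lemma card_ge_2I: "finite A \<Longrightarrow> x \<in> A \<Longrightarrow> y \<in> A \<Longrightarrow> x \<noteq> y \<Longrightarrow> 2 \<le> card A"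
  using card_mono[of A "{x, y}"] by simp

lemma bond_le_2: "bond_str gs \<alpha> p q \<le> 2"
  unfolding bond_str_def glue_bond_gs by (auto simp: gs_def split: option.split)

lemma nbrs_irrefl: "p \<notin> nbrs p"
  using nbrs_odd[of p p] by auto

context closed_asm
begin

text \<open>The extreme case is an edge tile with bonds 2, 2, 1; corners and inner tiles reach at
  most 4.\<close>

lemma valency_le_5: "valency \<alpha> p \<le> 5"
proof (cases "p \<in> dom \<alpha>")
  case True
  obtain x y where p: "p = (x, y)" by (meson surj_pair)
  obtain i j where h: "has \<alpha> (x, y) i j" using dom_has True p by blast
  then have "i \<in> {1, 2, 3}" "j \<in> {1, 2, 3}" unfolding has_def by auto
  then show ?thesis unfolding p valency_eq using bond_cases[OF h] by (auto simp: gs_def)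
next
  case False
  then have "bond p q = 0" for q using bond_str_dom[of gs \<alpha> p q] by auto
  then show ?thesis unfolding valency_def by simp
qed

lemma bonded_neighbour:
  assumes "p \<in> dom \<alpha>"
  obtains q where "q \<in> dom \<alpha>" "q \<noteq> p" "0 < bond p q"
proof -
  obtain r where "r \<in> dom \<alpha>" "r \<noteq> p" using two_neighbours[OF assms, of p] by blast
  then have "{p} \<noteq> dom \<alpha>" by blast
  then show ?thesis using linked_exit[OF conn, of "{p}"] assms that by blast
qed

text \<open>By \<open>domino_cut\<close>, a violation would make the pair removable at cost at most
  4. If the rest contains a bond, the component of that bond is separated from everything else: all
  crossing bonds end in the pair, and the complement is connected because every other component
  hangs on the pair. If the rest contains no bond, the assembly consists of two stars centred at
  \<open>a\<close> and \<open>b\<close>, and only their common bond crosses.\<close>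

lemma domino_valency:
  assumes "0 < bond a b"
  shows "4 + 2 * bond a b < valency \<alpha> a + valency \<alpha> b"
proof (rule ccontr)
  assume le: "\<not> ?thesis"
  let ?D = "dom \<alpha>" and ?S = "{a, b}"
  let ?B = "?D - ?S"
  have ab: "a \<in> ?D" "b \<in> ?D" "b \<in> nbrs a"
    using assms bond_str_dom bond_nbrs by blast+
  then have "a \<noteq> b" using nbrs_irrefl by blast
  have cost: "cut_str gs \<alpha> ?S ?B \<le> 4"
    using domino_cut[OF fin ab(1,2) \<open>a \<noteq> b\<close>, of \<alpha>] le by simp
  have linkS: "linked gs \<alpha> ?S"
    using linked_star[of "{a}" gs \<alpha> b] assms by (simp add: insert_commute)
  show False
  proof (cases "\<exists>x\<in>?B. \<exists>y\<in>?B. 0 < bond x y")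
    case True
    then obtain x y where xy: "x \<in> ?B" "y \<in> ?B" "0 < bond x y" by blast
    then have "x \<noteq> y" using bond_nbrs nbrs_irrefl by blast
    have "linked gs \<alpha> {x, y}"
      using linked_star[of "{x}" gs \<alpha> y] xy by (simp add: insert_commute)
    then obtain T where T: "{x, y} \<subseteq> T" "T \<subseteq> ?B" "linked gs \<alpha> T"
      "\<And>u v. u \<in> T \<Longrightarrow> v \<in> ?B - T \<Longrightarrow> bond u v = 0"
      using max_linked[of ?B "{x, y}" gs \<alpha>] fin xy by blast
    obtain U where U: "?S \<subseteq> U" "U \<subseteq> ?D - T" "linked gs \<alpha> U"
      "\<And>u v. u \<in> U \<Longrightarrow> v \<in> ?D - T - U \<Longrightarrow> bond u v = 0"
      using max_linked[of "?D - T" ?S gs \<alpha>] fin ab T(2) linkS by blast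
    have "U = ?D - T"
    proof (rule ccontr)
      assume "U \<noteq> ?D - T"
      then obtain p q where pq: "p \<in> ?D - T - U" "q \<in> ?D - (?D - T - U)" "0 < bond p q"
        using linked_exit[OF conn, of "?D - T - U"] U(2) T(1) xy by blast
      then have "0 < bond q p" using bond_str_sym by metis
      moreover have "q \<in> T \<or> q \<in> U" "p \<in> ?B - T" using pq U(1) by blast+
      ultimately show False using T(4)[of q p] U(4)[of q p] pq(1) by auto
    qed
    have fT: "finite T" "finite U" using T(2) U(2) fin finite_subset by blast+
    have "5 \<le> cut_str gs \<alpha> T U"
    proof (rule cut)
      show "T \<union> U = ?D" "T \<inter> U = {}" using T(2) \<open>U = ?D - T\<close> by auto
      show "2 \<le> card T" using T(1) \<open>x \<noteq> y\<close> by (intro card_ge_2I[OF fT(1), of x y]) auto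
      show "2 \<le> card U" using U(1) \<open>a \<noteq> b\<close> by (intro card_ge_2I[OF fT(2), of a b]) auto
    qed fact+
    moreover have "cut_str gs \<alpha> T U = cut_str gs \<alpha> T ?S"
      unfolding cut_str_def[of _ _ _ ?S]
    proof (rule cut_str_restrict)
      fix p q assume "p \<in> T" "q \<in> U" "(p, q) \<notin> T \<times> ?S"
      then show "bond p q = 0" using T(4)[of p q] \<open>U = ?D - T\<close> by blast
    qed (use fT U(1) in auto)
    moreover have "cut_str gs \<alpha> T ?S \<le> cut_str gs \<alpha> ?B ?S"
      using T(2) fin by (intro cut_str_mono) auto
    ultimately show False using cost cut_str_sym[of gs \<alpha> ?S ?B] by simp
  next
    case False
    have attach: "0 < bond x a \<or> 0 < bond x b" if "x \<in> ?B" for x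
    proof -
      have "x \<in> ?D" using that by blast
      then obtain q where q: "q \<in> ?D" "q \<noteq> x" "0 < bond x q" by (rule bonded_neighbour)
      then have "q \<notin> ?B" using False that by (metis (no_types))
      then have "q = a \<or> q = b" using q(1) by blast
      then show ?thesis using q(3) by auto
    qed
    have excl: "bond x b = 0" if "0 < bond x a" for x
    proof (rule ccontr)
      assume "bond x b \<noteq> 0"
      then have "b \<in> nbrs x" using bond_nbrs by blast
      moreover have "x \<in> nbrs a" using bond_nbrs[OF that] nbrs_sym by blast
      ultimately show False using nbrs_triangle[of x a b] ab(3) by blast
    qed
    let ?X = "{x \<in> ?B. 0 < bond x a}"
    let ?Y = "?B - ?X"
    \<comment> \<open>Each star needs a leaf in order to have two tiles.
      \<open>two_neighbours\<close> supplies a further neighbour of each centre, and without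
      triangles it cannot be bonded to the other centre.\<close>
    obtain y where "y \<in> ?D" "y \<in> nbrs b" "y \<noteq> a" using two_neighbours[OF ab(2), of a] by blast
    moreover from this have "y \<noteq> b" using nbrs_irrefl by blast
    moreover have "\<not> 0 < bond y a"
      using nbrs_triangle[of y b a] \<open>y \<in> nbrs b\<close> nbrs_sym[OF ab(3)] bond_nbrs[of gs \<alpha> y a] by blast
    ultimately have y: "y \<in> ?Y" by blast
    obtain z where "z \<in> ?D" "z \<in> nbrs a" "z \<noteq> b" using two_neighbours[OF ab(1), of b] by blast
    moreover from this have "z \<noteq> a" using nbrs_irrefl by blast
    moreover have "\<not> 0 < bond z b"
      using nbrs_triangle[of z a b] \<open>z \<in> nbrs a\<close> ab(3) bond_nbrs[of gs \<alpha> z b] by blast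
    ultimately have "z \<in> ?B" "\<not> 0 < bond z b" by blast+
    then have z: "z \<in> ?X" using attach[of z] by simp
    have "linked gs \<alpha> (insert a ?X)" by (rule linked_star) simp
    moreover have "linked gs \<alpha> (insert b ?Y)" using attach by (intro linked_star) blast
    moreover have "2 \<le> card (insert a ?X)" "2 \<le> card (insert b ?Y)"
      using card_ge_2I[of "insert a ?X" a z] card_ge_2I[of "insert b ?Y" b y] y z fin by auto
    moreover have "insert a ?X \<union> insert b ?Y = ?D" "insert a ?X \<inter> insert b ?Y = {}"
      using ab \<open>a \<noteq> b\<close> by auto
    ultimately have "5 \<le> cut_str gs \<alpha> (insert a ?X) (insert b ?Y)" by (intro cut)
    also have "\<dots> = (\<Sum>(p, q) \<in> {(a, b)}. bond p q)"
    proof (rule cut_str_restrict)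
      fix p q
      assume pq: "p \<in> insert a ?X" "q \<in> insert b ?Y" "(p, q) \<notin> {(a, b)}"
      show "bond p q = 0"
      proof (rule ccontr)
        assume "bond p q \<noteq> 0"
        then have "0 < bond p q" "0 < bond q p" using bond_str_sym[of gs \<alpha> p q] by auto
        moreover from this have "p \<notin> ?B \<or> q \<notin> ?B" using False by (metis (no_types))
        ultimately show False using pq excl[of p] by (cases "p = a"; cases "q = b") simp_all
      qed
    qed (use fin in auto)
    also have "\<dots> \<le> 2" by (simp add: bond_le_2)
    finally show False by simp
  qed
qed

lemma border_bonds:
  assumes h: "has \<alpha> (x, y) i j"
  shows "j \<noteq> 3 \<Longrightarrow> i \<noteq> 2 \<Longrightarrow> 0 < bond (x, y) (x + 1, y)"
    "j \<noteq> 3 \<Longrightarrow> i \<noteq> 1 \<Longrightarrow> 0 < bond (x, y) (x - 1, y)"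
    "i \<noteq> 3 \<Longrightarrow> j \<noteq> 2 \<Longrightarrow> 0 < bond (x, y) (x, y + 1)"
    "i \<noteq> 3 \<Longrightarrow> j \<noteq> 1 \<Longrightarrow> 0 < bond (x, y) (x, y - 1)"
proof -
  let ?p = "(x, y)"
  obtain e w n s where ewns: "e = bond ?p (x + 1, y)" "w = bond ?p (x - 1, y)"
      "n = bond ?p (x, y + 1)" "s = bond ?p (x, y - 1)"
    by blast
  have i: "i = 1 \<or> i = 2 \<or> i = 3" and j: "j = 1 \<or> j = 2 \<or> j = 3"
    using h unfolding has_def by auto
  \<comment> \<open>From 4 + 2 b < v + 5 over the natural numbers, with b the bond and v the valency
    here, it follows that 2 b \<le> v.\<close>
  have half: "2 * bond ?p q \<le> e + w + n + s" for q
  proof (cases "0 < bond ?p q")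
    case True
    then show ?thesis using domino_valency[OF True] valency_le_5[of q]
      unfolding valency_eq ewns by linarith
  qed simp
  have some: "0 < e \<or> 0 < w \<or> 0 < n \<or> 0 < s"
  proof -
    obtain q where q: "0 < bond ?p q" using bonded_neighbour[OF has_dom[OF h]] by blast
    then have "q \<in> nbrs ?p" by (rule bond_nbrs)
    then have "q = (x + 1, y) \<or> q = (x - 1, y) \<or> q = (x, y + 1) \<or> q = (x, y - 1)"
      unfolding nbrs_def by simp
    then show ?thesis using q unfolding ewns by (elim disjE) simp_all
  qed
  have vals: "e = 0 \<or> e = (if i = 2 then 0 else gs j)" "w = 0 \<or> w = (if i = 1 then 0 else gs j)"
    "n = 0 \<or> n = (if j = 2 then 0 else gs i)" "s = 0 \<or> s = (if j = 1 then 0 else gs i)"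
    using bond_cases[OF h] unfolding ewns by simp_all
  have le: "2 * e \<le> e + w + n + s" "2 * w \<le> e + w + n + s" "2 * n \<le> e + w + n + s"
    "2 * s \<le> e + w + n + s"
    using half[of "(x + 1, y)"] half[of "(x - 1, y)"] half[of "(x, y + 1)"] half[of "(x, y - 1)"]
    unfolding ewns by blast+
  \<comment> \<open>All nine tile types are checked separately; \<open>some\<close> excludes the
    solution of \<open>le\<close> in which all four bonds vanish.\<close>
  have "(j \<noteq> 3 \<and> i \<noteq> 2 \<longrightarrow> 0 < e) \<and> (j \<noteq> 3 \<and> i \<noteq> 1 \<longrightarrow> 0 < w) \<and>
        (i \<noteq> 3 \<and> j \<noteq> 2 \<longrightarrow> 0 < n) \<and> (i \<noteq> 3 \<and> j \<noteq> 1 \<longrightarrow> 0 < s)"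
    using i j
  proof (elim disjE)
  qed (use some vals le in \<open>auto simp: gs_def\<close>)
  then show "j \<noteq> 3 \<Longrightarrow> i \<noteq> 2 \<Longrightarrow> 0 < bond (x, y) (x + 1, y)"
    "j \<noteq> 3 \<Longrightarrow> i \<noteq> 1 \<Longrightarrow> 0 < bond (x, y) (x - 1, y)"
    "i \<noteq> 3 \<Longrightarrow> j \<noteq> 2 \<Longrightarrow> 0 < bond (x, y) (x, y + 1)"
    "i \<noteq> 3 \<Longrightarrow> j \<noteq> 1 \<Longrightarrow> 0 < bond (x, y) (x, y - 1)"
    unfolding ewns by blast+
qed

end

section \<open>Border runs and rectangular frames\<close>

text \<open>An injective walk cannot stay in a finite set for ever, so \<open>P\<close> fails at
  some position; at the first failure the step rule leaves only \<open>E\<close>.\<close>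

lemma first_exit:
  fixes f :: "nat \<Rightarrow> 'a"
  assumes "finite D" "inj f" "\<And>m. P (f m) \<Longrightarrow> f m \<in> D" "P (f 1) \<or> E (f 1)"
    "\<And>m. P (f m) \<Longrightarrow> P (f (Suc m)) \<or> E (f (Suc m))"
  shows "\<exists>n\<ge>1. E (f n) \<and> (\<forall>m. 0 < m \<longrightarrow> m < n \<longrightarrow> P (f m))"
proof -
  have "\<exists>n. 1 \<le> n \<and> \<not> P (f n)"
  proof (rule ccontr)
    assume "\<not> ?thesis"
    then have "f ` {1..} \<subseteq> D" using assms(3) by auto
    moreover have "infinite (f ` {1..})"
      using finite_imageD[of f "{1..}"] inj_on_subset[OF assms(2)] infinite_Ici by blast
    ultimately show False using assms(1) finite_subset by blast
  qed
  then obtain n where n: "1 \<le> n" "\<not> P (f n)" "\<And>m. m < n \<Longrightarrow> 1 \<le> m \<Longrightarrow> P (f m)"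
    using exists_least_iff[of "\<lambda>n. 1 \<le> n \<and> \<not> P (f n)"] by blast
  have "E (f n)"
  proof (cases "n = 1")
    case False
    then have "n = Suc (n - 1)" "1 \<le> n - 1" "n - 1 < n" using n(1) by auto
    then show ?thesis using n(2) n(3)[of "n - 1"] assms(5)[of "n - 1"] by metis
  qed (use n assms(4) in auto)
  then show ?thesis using n by (metis Suc_leI One_nat_def)
qed

context closed_asm
begin

text \<open>A bond on a border side forces equal glues, so the neighbour either continues the same
  border line or is the corner where that line ends.\<close>

lemma step_right:
  assumes "has \<alpha> (x, y) i j" "j \<noteq> 3" "i \<noteq> 2"
  shows "has \<alpha> (x + 1, y) 3 j \<or> has \<alpha> (x + 1, y) 2 j"
proof -
  have b: "0 < bond (x, y) (x + 1, y)" using border_bonds(1) assms by blast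
  then obtain i' j' where h: "has \<alpha> (x + 1, y) i' j'" using dom_has bond_str_dom by blast
  then have "i' \<noteq> 1 \<and> j' = j" using b bond_right[OF assms(1) h] by (auto split: if_splits)
  then show ?thesis using h unfolding has_def by auto
qed

lemma step_left:
  assumes "has \<alpha> (x, y) i j" "j \<noteq> 3" "i \<noteq> 1"
  shows "has \<alpha> (x - 1, y) 3 j \<or> has \<alpha> (x - 1, y) 1 j"
proof -
  have b: "0 < bond (x, y) (x - 1, y)" using border_bonds(2) assms by blast
  then obtain i' j' where h: "has \<alpha> (x - 1, y) i' j'" using dom_has bond_str_dom by blast
  then have "i' \<noteq> 2 \<and> j' = j"
    using b bond_right[of \<alpha> "x - 1" y i' j' i j] assms(1) bond_str_sym[of gs \<alpha> "(x, y)" "(x - 1, y)"]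
    by (auto split: if_splits)
  then show ?thesis using h unfolding has_def by auto
qed

lemma step_up:
  assumes "has \<alpha> (x, y) i j" "i \<noteq> 3" "j \<noteq> 2"
  shows "has \<alpha> (x, y + 1) i 3 \<or> has \<alpha> (x, y + 1) i 2"
proof -
  have b: "0 < bond (x, y) (x, y + 1)" using border_bonds(3) assms by blast
  then obtain i' j' where h: "has \<alpha> (x, y + 1) i' j'" using dom_has bond_str_dom by blast
  then have "j' \<noteq> 1 \<and> i' = i" using b bond_up[OF assms(1) h] by (auto split: if_splits)
  then show ?thesis using h unfolding has_def by auto
qed

lemma step_down:
  assumes "has \<alpha> (x, y) i j" "i \<noteq> 3" "j \<noteq> 1"
  shows "has \<alpha> (x, y - 1) i 3 \<or> has \<alpha> (x, y - 1) i 1"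
proof -
  have b: "0 < bond (x, y) (x, y - 1)" using border_bonds(4) assms by blast
  then obtain i' j' where h: "has \<alpha> (x, y - 1) i' j'" using dom_has bond_str_dom by blast
  then have "j' \<noteq> 2 \<and> i' = i"
    using b bond_up[of \<alpha> x "y - 1" i' j' i j] assms(1) bond_str_sym[of gs \<alpha> "(x, y)" "(x, y - 1)"]
    by (auto split: if_splits)
  then show ?thesis using h unfolding has_def by auto
qed

lemma int_walk:
  assumes "\<exists>n\<ge>1. E (f (int n)) \<and> (\<forall>m. 0 < m \<longrightarrow> m < n \<longrightarrow> P (f (int m)))"
  obtains n :: int where "0 < n" "E (f n)" "\<And>m. 0 < m \<Longrightarrow> m < n \<Longrightarrow> P (f m)"
proof -
  obtain n where n: "n \<ge> 1" "E (f (int n))" "\<forall>m. 0 < m \<longrightarrow> m < n \<longrightarrow> P (f (int m))"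
    using assms by blast
  show ?thesis
  proof (rule that[of "int n"])
    fix m :: int assume "0 < m" "m < int n"
    then show "P (f m)" using n(3)[rule_format, of "nat m"] by simp
  qed (use n in auto)
qed

lemma run_right:
  assumes "has \<alpha> (x, y) i j" "j \<noteq> 3" "i \<noteq> 2"
  obtains n :: int where "0 < n" "has \<alpha> (x + n, y) 2 j" "\<And>m. 0 < m \<Longrightarrow> m < n \<Longrightarrow> has \<alpha> (x + m, y) 3 j"
proof (rule int_walk[of "\<lambda>p. has \<alpha> p 2 j" "\<lambda>n. (x + n, y)" "\<lambda>p. has \<alpha> p 3 j"])
  show "\<exists>n\<ge>1. has \<alpha> (x + int n, y) 2 j \<and> (\<forall>m. 0 < m \<longrightarrow> m < n \<longrightarrow> has \<alpha> (x + int m, y) 3 j)"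
  proof (rule first_exit[OF fin, of "\<lambda>n. (x + int n, y)" "\<lambda>p. has \<alpha> p 3 j"])
    show "has \<alpha> (x + int (Suc m), y) 3 j \<or> has \<alpha> (x + int (Suc m), y) 2 j"
      if "has \<alpha> (x + int m, y) 3 j" for m
      using step_right[OF that assms(2)] by (simp add: ac_simps)
  qed (use step_right[OF assms] has_dom in \<open>auto simp: inj_def\<close>)
qed (use that in blast)

lemma run_left:
  assumes "has \<alpha> (x, y) i j" "j \<noteq> 3" "i \<noteq> 1"
  obtains n :: int where "0 < n" "has \<alpha> (x - n, y) 1 j" "\<And>m. 0 < m \<Longrightarrow> m < n \<Longrightarrow> has \<alpha> (x - m, y) 3 j"
proof (rule int_walk[of "\<lambda>p. has \<alpha> p 1 j" "\<lambda>n. (x - n, y)" "\<lambda>p. has \<alpha> p 3 j"])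
  show "\<exists>n\<ge>1. has \<alpha> (x - int n, y) 1 j \<and> (\<forall>m. 0 < m \<longrightarrow> m < n \<longrightarrow> has \<alpha> (x - int m, y) 3 j)"
  proof (rule first_exit[OF fin, of "\<lambda>n. (x - int n, y)" "\<lambda>p. has \<alpha> p 3 j"])
    show "has \<alpha> (x - int (Suc m), y) 3 j \<or> has \<alpha> (x - int (Suc m), y) 1 j"
      if "has \<alpha> (x - int m, y) 3 j" for m
      using step_left[OF that assms(2)] by (simp add: algebra_simps)
  qed (use step_left[OF assms] has_dom in \<open>auto simp: inj_def\<close>)
qed (use that in blast)

lemma run_up:
  assumes "has \<alpha> (x, y) i j" "i \<noteq> 3" "j \<noteq> 2"
  obtains n :: int where "0 < n" "has \<alpha> (x, y + n) i 2" "\<And>m. 0 < m \<Longrightarrow> m < n \<Longrightarrow> has \<alpha> (x, y + m) i 3"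
proof (rule int_walk[of "\<lambda>p. has \<alpha> p i 2" "\<lambda>n. (x, y + n)" "\<lambda>p. has \<alpha> p i 3"])
  show "\<exists>n\<ge>1. has \<alpha> (x, y + int n) i 2 \<and> (\<forall>m. 0 < m \<longrightarrow> m < n \<longrightarrow> has \<alpha> (x, y + int m) i 3)"
  proof (rule first_exit[OF fin, of "\<lambda>n. (x, y + int n)" "\<lambda>p. has \<alpha> p i 3"])
    show "has \<alpha> (x, y + int (Suc m)) i 3 \<or> has \<alpha> (x, y + int (Suc m)) i 2"
      if "has \<alpha> (x, y + int m) i 3" for m
      using step_up[OF that assms(2)] by (simp add: ac_simps)
  qed (use step_up[OF assms] has_dom in \<open>auto simp: inj_def\<close>)
qed (use that in blast)

lemma run_down:
  assumes "has \<alpha> (x, y) i j" "i \<noteq> 3" "j \<noteq> 1"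
  obtains n :: int where "0 < n" "has \<alpha> (x, y - n) i 1" "\<And>m. 0 < m \<Longrightarrow> m < n \<Longrightarrow> has \<alpha> (x, y - m) i 3"
proof (rule int_walk[of "\<lambda>p. has \<alpha> p i 1" "\<lambda>n. (x, y - n)" "\<lambda>p. has \<alpha> p i 3"])
  show "\<exists>n\<ge>1. has \<alpha> (x, y - int n) i 1 \<and> (\<forall>m. 0 < m \<longrightarrow> m < n \<longrightarrow> has \<alpha> (x, y - int m) i 3)"
  proof (rule first_exit[OF fin, of "\<lambda>n. (x, y - int n)" "\<lambda>p. has \<alpha> p i 3"])
    show "has \<alpha> (x, y - int (Suc m)) i 3 \<or> has \<alpha> (x, y - int (Suc m)) i 1"
      if "has \<alpha> (x, y - int m) i 3" for m
      using step_down[OF that assms(2)] by (simp add: algebra_simps)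
  qed (use step_down[OF assms] has_dom in \<open>auto simp: inj_def\<close>)
qed (use that in blast)

text \<open>\<open>a\<close> is the distance between the two corners, so the row has
  \<open>a + 1\<close> cells.\<close>

definition floor_row :: "int \<Rightarrow> int \<Rightarrow> int \<Rightarrow> bool" where
  "floor_row x y a \<longleftrightarrow> 0 < a \<and> has \<alpha> (x, y) 1 1 \<and> has \<alpha> (x + a, y) 2 1 \<and>
     (\<forall>m. 0 < m \<longrightarrow> m < a \<longrightarrow> has \<alpha> (x + m, y) 3 1)"

text \<open>A tile in the leftmost occupied column has no open west side, hence lies on a left
  border. Following that border down leads to a lower left corner, whose row runs to the
  right.\<close>

lemma floor_row_exists: "\<exists>x y a. floor_row x y a"
proof -
  have fx: "finite (fst ` dom \<alpha>)" "fst ` dom \<alpha> \<noteq> {}" using fin ne by auto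
  obtain p where p: "p \<in> dom \<alpha>" "fst p = Min (fst ` dom \<alpha>)"
    using Min_in[OF fx] by (metis imageE)
  obtain x y where xy: "p = (x, y)" by (rule prod.exhaust)
  obtain i j where h: "has \<alpha> (x, y) i j" using dom_has p xy by blast
  have "(x - 1, y) \<notin> dom \<alpha>"
  proof
    assume "(x - 1, y) \<in> dom \<alpha>"
    then have "x - 1 \<in> fst ` dom \<alpha>" by force
    then show False using Min_le[OF fx(1)] p(2) xy by fastforce
  qed
  then have "i = 1" using closed_side(2)[OF h] by blast
  obtain y' where h': "has \<alpha> (x, y') 1 1"
  proof (cases "j = 1")
    case False
    then show ?thesis using run_down[of x y 1 j] h \<open>i = 1\<close> that by auto
  qed (use h \<open>i = 1\<close> that in blast)
  obtain n where "0 < n" "has \<alpha> (x + n, y') 2 1" "\<And>m. 0 < m \<Longrightarrow> m < n \<Longrightarrow> has \<alpha> (x + m, y') 3 1"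
    using run_right[OF h'] by auto
  then show ?thesis using h' unfolding floor_row_def by blast
qed

lemma shortest_floor_row:
  obtains x y a where "floor_row x y a" "\<And>x' y' a'. floor_row x' y' a' \<Longrightarrow> a \<le> a'"
proof -
  obtain x y a where "floor_row x y a" using floor_row_exists by blast
  then have "\<exists>n x y. floor_row x y (int n)"
    unfolding floor_row_def by (metis pos_int_cases)
  then obtain n where n: "\<exists>x y. floor_row x y (int n)" "\<And>m. m < n \<Longrightarrow> \<not> (\<exists>x y. floor_row x y (int m))"
    using exists_least_iff[of "\<lambda>n. \<exists>x y. floor_row x y (int n)"] by blast
  then obtain x y where xy: "floor_row x y (int n)" by blast
  show ?thesis
  proof (rule that[OF xy])
    fix x' y' a' assume *: "floor_row x' y' a'"
    then have "a' = int (nat a')" unfolding floor_row_def by simp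
    then have "\<not> nat a' < n" using n(2)[of "nat a'"] * by metis
    moreover have "0 < a'" using * unfolding floor_row_def by simp
    ultimately show "int n \<le> a'" by linarith
  qed
qed

end

context closed_asm
begin

definition frame :: "int \<Rightarrow> int \<Rightarrow> int \<Rightarrow> int \<Rightarrow> bool" where
  "frame x y a b \<longleftrightarrow> 0 < a \<and> 0 < b \<and>
     has \<alpha> (x, y) 1 1 \<and> has \<alpha> (x + a, y) 2 1 \<and> has \<alpha> (x, y + b) 1 2 \<and> has \<alpha> (x + a, y + b) 2 2 \<and>
     (\<forall>m. 0 < m \<longrightarrow> m < a \<longrightarrow> has \<alpha> (x + m, y) 3 1 \<and> has \<alpha> (x + m, y + b) 3 2) \<and>
     (\<forall>m. 0 < m \<longrightarrow> m < b \<longrightarrow> has \<alpha> (x, y + m) 1 3 \<and> has \<alpha> (x + a, y + m) 2 3)"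

text \<open>A spiral can only turn inwards, where it runs into a shorter floor row.\<close>
lemma shortest_floor_row_frame:
  assumes fl: "floor_row x y a" and min: "\<And>x' y' a'. floor_row x' y' a' \<Longrightarrow> a \<le> a'"
  shows "\<exists>b. frame x y a b"
proof -
  note clash = has_inject[of \<alpha>]
  have a: "0 < a" and c1: "has \<alpha> (x, y) 1 1" and c2: "has \<alpha> (x + a, y) 2 1"
    and bot: "\<And>m. 0 < m \<Longrightarrow> m < a \<Longrightarrow> has \<alpha> (x + m, y) 3 1"
    using fl unfolding floor_row_def by auto
  obtain b where b: "0 < b" "has \<alpha> (x, y + b) 1 2"
    and left: "\<And>m. 0 < m \<Longrightarrow> m < b \<Longrightarrow> has \<alpha> (x, y + m) 1 3"
    using run_up[OF c1] by auto
  obtain c where c: "0 < c" "has \<alpha> (x + a, y + c) 2 2"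
    and right: "\<And>m. 0 < m \<Longrightarrow> m < c \<Longrightarrow> has \<alpha> (x + a, y + m) 2 3"
    using run_up[OF c2] by auto
  \<comment> \<open>From an upper right corner strictly between the walls, a right wall runs down
    and must stop above the given floor row; from its foot a floor row runs left and must stop
    before the left wall. That row is shorter than \<open>a\<close>. \<open>no_left\<close> is the
    mirror image.\<close>
  have no_right: False if d: "0 < d" "d < a" and l: "0 < l" "l \<le> b" and h: "has \<alpha> (x + d, y + l) 2 2" for d l
  proof -
    obtain e where e: "0 < e" "has \<alpha> (x + d, y + l - e) 2 1"
      "\<And>m. 0 < m \<Longrightarrow> m < e \<Longrightarrow> has \<alpha> (x + d, y + l - m) 2 3"
      using run_down[OF h] by auto
    have el: "e < l"
    proof (rule ccontr)
      assume "\<not> e < l"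
      then have "has \<alpha> (x + d, y) 2 1 \<or> has \<alpha> (x + d, y) 2 3"
        using e(2) e(3)[of l] l by (cases "e = l") auto
      then show False using clash bot[OF d] by force
    qed
    obtain f where f: "0 < f" "has \<alpha> (x + d - f, y + l - e) 1 1"
      "\<And>m. 0 < m \<Longrightarrow> m < f \<Longrightarrow> has \<alpha> (x + d - m, y + l - e) 3 1"
      using run_left[OF e(2)] by auto
    have "f < d"
    proof (rule ccontr)
      assume "\<not> f < d"
      then have "has \<alpha> (x, y + (l - e)) 1 1 \<or> has \<alpha> (x, y + (l - e)) 3 1"
        using f(2) f(3)[of d] d by (cases "f = d") (auto simp: algebra_simps)
      moreover have "has \<alpha> (x, y + (l - e)) 1 3" using left[of "l - e"] e(1) el l by simp
      ultimately show False using clash by force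
    qed
    have "has \<alpha> (x + d - f + m, y + l - e) 3 1" if "0 < m" "m < f" for m
      using f(3)[of "f - m"] that by (simp add: algebra_simps)
    then have "floor_row (x + d - f) (y + l - e) f"
      unfolding floor_row_def using f(1,2) e(2) by simp
    then show False using min \<open>f < d\<close> d by fastforce
  qed
  have no_left: False if d: "0 < d" "d < a" and l: "0 < l" "l \<le> c" and h: "has \<alpha> (x + d, y + l) 1 2" for d l
  proof -
    obtain e where e: "0 < e" "has \<alpha> (x + d, y + l - e) 1 1"
      "\<And>m. 0 < m \<Longrightarrow> m < e \<Longrightarrow> has \<alpha> (x + d, y + l - m) 1 3"
      using run_down[OF h] by auto
    have el: "e < l"
    proof (rule ccontr)
      assume "\<not> e < l"
      then have "has \<alpha> (x + d, y) 1 1 \<or> has \<alpha> (x + d, y) 1 3"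
        using e(2) e(3)[of l] l by (cases "e = l") auto
      then show False using clash bot[OF d] by force
    qed
    obtain f where f: "0 < f" "has \<alpha> (x + d + f, y + l - e) 2 1"
      "\<And>m. 0 < m \<Longrightarrow> m < f \<Longrightarrow> has \<alpha> (x + d + m, y + l - e) 3 1"
      using run_right[OF e(2)] by auto
    have "f < a - d"
    proof (rule ccontr)
      assume "\<not> f < a - d"
      then have "has \<alpha> (x + a, y + (l - e)) 2 1 \<or> has \<alpha> (x + a, y + (l - e)) 3 1"
        using f(2) f(3)[of "a - d"] d by (cases "f = a - d") (auto simp: algebra_simps)
      moreover have "has \<alpha> (x + a, y + (l - e)) 2 3" using right[of "l - e"] e(1) el l by simp
      ultimately show False using clash by force
    qed
    moreover have "floor_row (x + d) (y + l - e) f"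
      unfolding floor_row_def using f e(2) by simp
    ultimately show False using min d by fastforce
  qed
  \<comment> \<open>If the right wall ended first, its top row would run left and be stopped by the
    left wall, producing the upper left corner that \<open>no_left\<close> forbids.\<close>
  have "b \<le> c"
  proof (rule ccontr)
    assume "\<not> b \<le> c"
    then have cb: "c < b" by simp
    obtain d where d: "0 < d" "has \<alpha> (x + a - d, y + c) 1 2"
      "\<And>m. 0 < m \<Longrightarrow> m < d \<Longrightarrow> has \<alpha> (x + a - m, y + c) 3 2"
      using run_left[OF c(2)] by auto
    have "d < a"
    proof (rule ccontr)
      assume "\<not> d < a"
      then have "has \<alpha> (x, y + c) 1 2 \<or> has \<alpha> (x, y + c) 3 2"
        using d(2) d(3)[of a] a by (cases "d = a") auto
      then show False using clash left[OF c(1) cb] by force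
    qed
    then show False using no_left[of "a - d" c] d c(1) by (simp add: algebra_simps)
  qed
  obtain d where d: "0 < d" "has \<alpha> (x + d, y + b) 2 2"
    and top: "\<And>m. 0 < m \<Longrightarrow> m < d \<Longrightarrow> has \<alpha> (x + m, y + b) 3 2"
    using run_right[OF b(2)] by auto
  have "\<exists>j. has \<alpha> (x + a, y + b) 2 j"
    using c(2) right[of b] b(1) \<open>b \<le> c\<close> by (cases "b = c") auto
  then obtain j where j: "has \<alpha> (x + a, y + b) 2 j" ..
  \<comment> \<open>The top row from the left wall cannot pass column \<open>x + a\<close>, which
    belongs to the right wall at this height, and by \<open>no_right\<close> it cannot end
    earlier.\<close>
  have "\<not> a < d"
  proof
    assume "a < d"
    then show False using clash[OF j top[OF a]] by simp
  qed
  moreover have "\<not> d < a" using no_right[of d b] d b(1) by auto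
  ultimately have "d = a" by simp
  have "\<not> b < c"
  proof
    assume "b < c"
    then show False using clash[OF d(2)] right[OF b(1)] \<open>d = a\<close> by fastforce
  qed
  then have "b = c" using \<open>b \<le> c\<close> by simp
  have "frame x y a b"
    unfolding frame_def using a b c1 c2 c(2) bot left right top \<open>d = a\<close> \<open>b = c\<close> by blast
  then show ?thesis ..
qed

text \<open>Every border tile inside would lead to a lower left corner inside: top rows are followed
  left, walls down and floor rows left, each run being stopped by the frame. The floor row starting
  at that corner ends before the right side of the frame, so it is shorter than
  \<open>a\<close>.\<close>

lemma frame_interior:
  assumes fr: "frame x y a b" and min: "\<And>x' y' a'. floor_row x' y' a' \<Longrightarrow> a \<le> a'"
    and "0 < m" "m < a" "0 < l" "l < b" "has \<alpha> (x + m, y + l) i j"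
  shows "i = 3 \<and> j = 3"
proof -
  note clash = has_inject[of \<alpha>]
  have sides: "has \<alpha> (x + m, y) 3 1" if "0 < m" "m < a" for m
    using fr that unfolding frame_def by blast
  have sides': "has \<alpha> (x, y + l) 1 3" "has \<alpha> (x + a, y + l) 2 3" if "0 < l" "l < b" for l
    using fr that unfolding frame_def by blast+
  have no11: False if pt: "0 < m" "m < a" "0 < l" "l < b" "has \<alpha> (x + m, y + l) 1 1" for m l
  proof -
    obtain f where f: "0 < f" "has \<alpha> (x + m + f, y + l) 2 1"
      "\<And>n. 0 < n \<Longrightarrow> n < f \<Longrightarrow> has \<alpha> (x + m + n, y + l) 3 1"
      using run_right[OF pt(5)] by auto
    have "f < a - m"
    proof (rule ccontr)
      assume "\<not> f < a - m"
      then have "has \<alpha> (x + a, y + l) 2 1 \<or> has \<alpha> (x + a, y + l) 3 1"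
        using f(2) f(3)[of "a - m"] pt by (cases "f = a - m") auto
      then show False using clash sides'(2)[OF pt(3,4)] by force
    qed
    moreover have "floor_row (x + m) (y + l) f" unfolding floor_row_def using f pt(5) by simp
    ultimately show False using min pt by fastforce
  qed
  have no_floor: False if pt: "0 < m" "m < a" "0 < l" "l < b" "has \<alpha> (x + m, y + l) i 1" for m l i
  proof (cases "i = 1")
    case False
    obtain n where n: "0 < n" "has \<alpha> (x + m - n, y + l) 1 1"
      "\<And>k. 0 < k \<Longrightarrow> k < n \<Longrightarrow> has \<alpha> (x + m - k, y + l) 3 1"
      using run_left[OF pt(5)] False by auto
    have "n < m"
    proof (rule ccontr)
      assume "\<not> n < m"
      then have "has \<alpha> (x, y + l) 1 1 \<or> has \<alpha> (x, y + l) 3 1"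
        using n(2) n(3)[of m] pt by (cases "n = m") auto
      then show False using clash sides'(1)[OF pt(3,4)] by force
    qed
    then show False using no11[of "m - n" l] n pt by (simp add: algebra_simps)
  qed (use no11 pt in blast)
  have no_wall: False if pt: "0 < m" "m < a" "0 < l" "l < b" "has \<alpha> (x + m, y + l) i j" "i \<noteq> 3" for m l i j
  proof (cases "j = 1")
    case False
    obtain n where n: "0 < n" "has \<alpha> (x + m, y + l - n) i 1"
      "\<And>k. 0 < k \<Longrightarrow> k < n \<Longrightarrow> has \<alpha> (x + m, y + l - k) i 3"
      using run_down[OF pt(5)] False pt(6) by auto
    have "n < l"
    proof (rule ccontr)
      assume "\<not> n < l"
      then have "has \<alpha> (x + m, y) i 1 \<or> has \<alpha> (x + m, y) i 3"
        using n(2) n(3)[of l] pt by (cases "n = l") auto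
      then show False using clash sides[OF pt(1,2)] pt(6) by force
    qed
    then show False using no_floor[of m "l - n"] n pt by (simp add: algebra_simps)
  qed (use no_floor pt in blast)
  have i: "i = 3" using no_wall assms(3-7) by blast
  have "j \<noteq> 1" using no_floor assms(3-7) by blast
  moreover have "j \<noteq> 2"
  proof
    assume "j = 2"
    then obtain n where n: "0 < n" "has \<alpha> (x + m - n, y + l) 1 2"
      "\<And>k. 0 < k \<Longrightarrow> k < n \<Longrightarrow> has \<alpha> (x + m - k, y + l) 3 2"
      using run_left[OF assms(7)] i by auto
    have "n < m"
    proof (rule ccontr)
      assume "\<not> n < m"
      then have "has \<alpha> (x, y + l) 1 2 \<or> has \<alpha> (x, y + l) 3 2"
        using n(2) n(3)[of m] assms(3) by (cases "n = m") auto
      then show False using clash sides'(1)[OF assms(5,6)] by force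
    qed
    then show False using no_wall[of "m - n" l 1 2] n assms(3-6) by (simp add: algebra_simps)
  qed
  ultimately have "j = 3" using assms(7) unfolding has_def by auto
  then show ?thesis using i by simp
qed

end

section \<open>Rectangles and their straight cuts\<close>

definition code :: "nat \<Rightarrow> int \<Rightarrow> nat" where
  "code n x = (if x = 0 then 1 else if x = int n - 1 then 2 else 3)"

definition box :: "nat \<Rightarrow> nat \<Rightarrow> pos set" where
  "box w h = {0..<int w} \<times> {0..<int h}"

definition rect :: "nat \<Rightarrow> nat \<Rightarrow> assembly" where
  "rect w h p = (if p \<in> box w h then Some (tile (code w (fst p)) (code h (snd p))) else None)"

lemma dom_rect: "dom (rect w h) = box w h"
  by (rule set_eqI) (simp only: domIff rect_def split: if_split, simp)

lemma has_rect: "(x, y) \<in> box w h \<Longrightarrow> has (rect w h) (x, y) (code w x) (code h y)"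
  unfolding rect_def has_def code_def by simp

lemma gs_code: "2 \<le> n \<Longrightarrow>
    gs (code n x) = 1 + (if x = 0 then 1 else 0) + (if x = int n - 1 then 1 else 0)"
  unfolding code_def gs_def by simp

lemma gs_code_ge_1: "1 \<le> gs (code n x)"
  unfolding code_def gs_def by simp

text \<open>Each of the \<open>n\<close> positions contributes 1 and each of the two ends one more.
  This is the source of the summand 2 in the cost of straight cuts; \<open>2 \<le> n\<close> keeps
  the ends distinct.\<close>

lemma sum_gs_code: "2 \<le> n \<Longrightarrow> (\<Sum>x\<in>{0..<int n}. gs (code n x)) = n + 2"
proof -
  assume n: "2 \<le> n"
  have "(\<Sum>x\<in>{0..<int n}. gs (code n x)) = (\<Sum>x\<in>{0..<int n}. 1)
      + (\<Sum>x\<in>{0..<int n}. if x = 0 then 1 else 0) + (\<Sum>x\<in>{0..<int n}. if x = int n - 1 then 1 else 0)"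
    by (simp only: gs_code[OF n] sum.distrib)
  then show ?thesis using n by simp
qed

lemma rect_bond_right:
  "(x, y) \<in> box w h \<Longrightarrow> (x + 1, y) \<in> box w h
    \<Longrightarrow> bond_str gs (rect w h) (x, y) (x + 1, y) = gs (code h y)"
  using bond_right[OF has_rect has_rect, of x y w h] unfolding box_def code_def by auto

lemma rect_bond_up:
  "(x, y) \<in> box w h \<Longrightarrow> (x, y + 1) \<in> box w h
    \<Longrightarrow> bond_str gs (rect w h) (x, y) (x, y + 1) = gs (code w x)"
  using bond_up[OF has_rect has_rect, of x y w h] unfolding box_def code_def by auto

text \<open>Each cell is joined to the lower left one by going left along its row and then down the
  first column.\<close>

lemma linked_subrect:
  assumes "{x1..<x2} \<times> {y1..<y2} \<subseteq> box w h"
  shows "linked gs (rect w h) ({x1..<x2} \<times> {y1..<y2})" (is "linked _ _ ?A")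
proof (rule linked_root[where a = "(x1, y1)"])
  fix p assume p: "p \<in> ?A"
  obtain x y where xy: "p = (x, y)" by (rule prod.exhaust)
  let ?R = "(links gs (rect w h) ?A)\<^sup>*"
  have mem: "(u, v) \<in> box w h" if "x1 \<le> u" "u < x2" "y1 \<le> v" "v < y2" for u v
    using assms that by auto
  have y: "y1 \<le> y" "y < y2" using p xy by auto
  have x: "x1 \<le> x" "x < x2" using p xy by auto
  have "x < x2 \<longrightarrow> ((x, y), (x1, y)) \<in> ?R" using x(1)
  proof (induction x rule: int_ge_induct)
    case (step x)
    show ?case
    proof
      assume *: "x + 1 < x2"
      have "0 < bond_str gs (rect w h) (x, y) (x + 1, y)"
        using rect_bond_right[OF mem mem, of x y] gs_code_ge_1[of h y] * step.hyps y by simp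
      then have "((x + 1, y), (x, y)) \<in> links gs (rect w h) ?A"
        using * step.hyps y by (simp add: links_def bond_str_sym)
      then show "((x + 1, y), (x1, y)) \<in> ?R"
        using step.IH * by (meson converse_rtrancl_into_rtrancl less_trans zless_add1_eq)
    qed
  qed simp
  moreover have "y < y2 \<longrightarrow> ((x1, y), (x1, y1)) \<in> ?R" using y(1)
  proof (induction y rule: int_ge_induct)
    case (step y)
    show ?case
    proof
      assume *: "y + 1 < y2"
      have "0 < bond_str gs (rect w h) (x1, y) (x1, y + 1)"
        using rect_bond_up[OF mem mem, of x1 y] gs_code_ge_1[of w x1] * step.hyps x by simp
      then have "((x1, y + 1), (x1, y)) \<in> links gs (rect w h) ?A"
        using * step.hyps x by (simp add: links_def bond_str_sym)
      then show "((x1, y + 1), (x1, y1)) \<in> ?R"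
        using step.IH * by (meson converse_rtrancl_into_rtrancl less_trans zless_add1_eq)
    qed
  qed simp
  ultimately show "(p, (x1, y1)) \<in> ?R" 
    using x(2) y(2) rtrancl_trans[of "(x, y)" "(x1, y)" "links gs (rect w h) ?A" "(x1, y1)"]
    unfolding xy by blast
qed

lemma rect_horizontal_cut:
  assumes "2 \<le> w" "0 < s" "s < h"
  shows "cut_str gs (rect w h) ({0..<int w} \<times> {0..<int s}) ({0..<int w} \<times> {int s..<int h}) = w + 2"
proof -
  let ?f = "\<lambda>x. ((x, int s - 1), (x, int s))"
  have "cut_str gs (rect w h) ({0..<int w} \<times> {0..<int s}) ({0..<int w} \<times> {int s..<int h})
      = (\<Sum>(p, q)\<in>?f ` {0..<int w}. bond_str gs (rect w h) p q)"
  proof (rule cut_str_restrict)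
    fix p q assume *: "p \<in> {0..<int w} \<times> {0..<int s}" "q \<in> {0..<int w} \<times> {int s..<int h}"
      "(p, q) \<notin> ?f ` {0..<int w}"
    have "q \<notin> nbrs p" using * unfolding nbrs_def by (cases p; cases q) auto
    then show "bond_str gs (rect w h) p q = 0" using bond_nbrs by blast
  qed (use assms in auto)
  also have "\<dots> = (\<Sum>x\<in>{0..<int w}. bond_str gs (rect w h) (x, int s - 1) (x, int s))"
    by (subst sum.reindex) (auto simp: inj_on_def)
  also have "\<dots> = (\<Sum>x\<in>{0..<int w}. gs (code w x))"
    using rect_bond_up[of _ "int s - 1" w h] assms by (intro sum.cong) (auto simp: box_def)
  finally show ?thesis using sum_gs_code[OF assms(1)] by simp
qed

lemma rect_vertical_cut:
  assumes "2 \<le> h" "0 < s" "s < w"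
  shows "cut_str gs (rect w h) ({0..<int s} \<times> {0..<int h}) ({int s..<int w} \<times> {0..<int h}) = h + 2"
proof -
  let ?f = "\<lambda>y. ((int s - 1, y), (int s, y))"
  have "cut_str gs (rect w h) ({0..<int s} \<times> {0..<int h}) ({int s..<int w} \<times> {0..<int h})
      = (\<Sum>(p, q)\<in>?f ` {0..<int h}. bond_str gs (rect w h) p q)"
  proof (rule cut_str_restrict)
    fix p q assume *: "p \<in> {0..<int s} \<times> {0..<int h}" "q \<in> {int s..<int w} \<times> {0..<int h}"
      "(p, q) \<notin> ?f ` {0..<int h}"
    have "q \<notin> nbrs p" using * unfolding nbrs_def by (cases p; cases q) auto
    then show "bond_str gs (rect w h) p q = 0" using bond_nbrs by blast
  qed (use assms in auto)
  also have "\<dots> = (\<Sum>y\<in>{0..<int h}. bond_str gs (rect w h) (int s - 1, y) (int s, y))"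
    by (subst sum.reindex) (auto simp: inj_on_def)
  also have "\<dots> = (\<Sum>y\<in>{0..<int h}. gs (code h y))"
    using rect_bond_right[of "int s - 1" _ w h] assms by (intro sum.cong) (auto simp: box_def)
  finally show ?thesis using sum_gs_code[OF assms(1)] by simp
qed

lemma wf_rect: "0 < w \<Longrightarrow> 0 < h \<Longrightarrow> wf_asm tiles gs (rect w h)"
proof -
  assume "0 < w" "0 < h"
  moreover have "ran (rect w h) \<subseteq> tiles"
  proof
    fix t assume "t \<in> ran (rect w h)"
    then obtain p where "rect w h p = Some t" unfolding ran_def by blast
    then have "t = tile (code w (fst p)) (code h (snd p))" unfolding rect_def by (simp split: if_splits)
    then show "t \<in> tiles" using tile_in_tiles by (simp add: code_def)
  qed
  moreover have "linked gs (rect w h) (box w h)"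
    using linked_subrect[of 0 "int w" 0 "int h" w h] unfolding box_def by simp
  ultimately show ?thesis unfolding wf_asm_def dom_rect by (auto simp: box_def)
qed

lemma (in closed_asm) eq_rect:
  obtains x y w h where "2 \<le> w" "2 \<le> h" "\<alpha> = translate (x, y) (rect w h)"
proof -
  obtain x y a where fl: "floor_row x y a" and min: "\<And>x' y' a'. floor_row x' y' a' \<Longrightarrow> a \<le> a'"
    using shortest_floor_row by blast
  obtain b where fr: "frame x y a b" using shortest_floor_row_frame[OF fl] min by blast
  have interior: "i = 3 \<and> j = 3"
    if "0 < m" "m < a" "0 < l" "l < b" "has \<alpha> (x + m, y + l) i j" for m l i j
    using frame_interior[OF fr _ that] min by blast
  have ab: "0 < a" "0 < b" using fr unfolding frame_def by auto
  \<comment> \<open>The frame records distances between corner tiles; side lengths are one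
    larger.\<close>
  define w h where wh: "w = nat (a + 1)" "h = nat (b + 1)"
  have fill: "int l < b \<longrightarrow> 0 < l \<longrightarrow> has \<alpha> (x + m, y + int l) 3 3" if m: "0 < m" "m < a" for m l
  proof (induction l)
    case (Suc l)
    show ?case
    proof (intro impI)
      assume l: "int (Suc l) < b"
      have "\<exists>j. has \<alpha> (x + m, y + int l) 3 j \<and> j \<noteq> 2"
        using Suc l fr m unfolding frame_def by (cases "l = 0") force+
      then have "(x + m, y + int l + 1) \<in> dom \<alpha>" using closed_side(3) by blast
      then obtain i j where h: "has \<alpha> (x + m, y + int (Suc l)) i j"
        using dom_has by (metis add.assoc of_nat_Suc add.commute)
      then show "has \<alpha> (x + m, y + int (Suc l)) 3 3"
        using interior[OF m _ l h] by simp
    qed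
  qed simp
  have cell: "has \<alpha> (x + m, y + l) (code w m) (code h l)" if "0 \<le> m" "m \<le> a" "0 \<le> l" "l \<le> b" for m l
  proof -
    have filled: "has \<alpha> (x + m, y + l) 3 3" if "0 < m" "m < a" "0 < l" "l < b"
      using fill[of m "nat l"] that by simp
    have "m = 0 \<or> m = a \<or> 0 < m \<and> m < a" "l = 0 \<or> l = b \<or> 0 < l \<and> l < b"
      using that by linarith+
    then show ?thesis
      by (elim disjE) (use filled fr ab in \<open>simp_all add: frame_def code_def wh\<close>)
  qed
  let ?A = "shift (x, y) ` box w h"
  have coords: thesis if "\<And>m l. p = (x + m, y + l) \<Longrightarrow> thesis" for p thesis
    using that[of "fst p - x" "snd p - y"] by simp
  have inA: "(x + m, y + l) \<in> ?A \<longleftrightarrow> 0 \<le> m \<and> m \<le> a \<and> 0 \<le> l \<and> l \<le> b" for m l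
    using ab by (auto simp: shift_def box_def wh image_iff)
  \<comment> \<open>The filled rectangle has null glues on its outer sides, so no bond leaves it,
    and connectedness excludes any further tile.\<close>
  have "?A = dom \<alpha>"
  proof (rule ccontr)
    assume "?A \<noteq> dom \<alpha>"
    moreover have "?A \<subseteq> dom \<alpha>"
    proof
      fix p assume p: "p \<in> ?A"
      obtain m l where ml: "p = (x + m, y + l)" by (rule coords)
      show "p \<in> dom \<alpha>" using p has_dom[OF cell[of m l]] inA[of m l] unfolding ml by simp
    qed
    moreover have "?A \<noteq> {}" using inA[of 0 0] ab by auto
    ultimately obtain p q where pq: "p \<in> ?A" "q \<in> dom \<alpha> - ?A" "0 < bond p q"
      using linked_exit[OF conn] by metis
    obtain m l where p: "p = (x + m, y + l)" by (rule coords)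
    have ml: "0 \<le> m" "m \<le> a" "0 \<le> l" "l \<le> b" using pq(1) inA unfolding p by auto
    have q: "q \<in> {(x + m + 1, y + l), (x + m - 1, y + l), (x + m, y + l + 1), (x + m, y + l - 1)}"
      using bond_nbrs[OF pq(3)] unfolding p nbrs_def by simp
    have out: "(x + m + 1, y + l) \<in> ?A \<or> code w m = 2" "(x + m - 1, y + l) \<in> ?A \<or> code w m = 1"
      "(x + m, y + l + 1) \<in> ?A \<or> code h l = 2" "(x + m, y + l - 1) \<in> ?A \<or> code h l = 1"
      using inA[of "m + 1" l] inA[of "m - 1" l] inA[of m "l + 1"] inA[of m "l - 1"] ml ab
      by (auto simp: code_def wh algebra_simps)
    note bonds = bond_cases[OF cell[OF ml]]
    from q consider (E) "q = (x + m + 1, y + l)" | (W) "q = (x + m - 1, y + l)"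
      | (N) "q = (x + m, y + l + 1)" | (S) "q = (x + m, y + l - 1)" by blast
    then show False
    proof cases
      case E
      then have "code w m = 2" using out(1) pq(2) by simp
      then show False using bonds(1) pq(3) unfolding p E by simp
    next
      case W
      then have "code w m = 1" using out(2) pq(2) by simp
      then show False using bonds(2) pq(3) unfolding p W by simp
    next
      case N
      then have "code h l = 2" using out(3) pq(2) by simp
      then show False using bonds(3) pq(3) unfolding p N by simp
    next
      case S
      then have "code h l = 1" using out(4) pq(2) by simp
      then show False using bonds(4) pq(3) unfolding p S by simp
    qed
  qed
  moreover have "\<alpha> (shift (x, y) p) = rect w h p" if "p \<in> box w h" for p
  proof -
    obtain m l where p: "p = (m, l)" by (rule prod.exhaust)
    have "0 \<le> m" "m \<le> a" "0 \<le> l" "l \<le> b" using that ab unfolding p box_def wh by auto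
    from cell[OF this] show ?thesis
      using that unfolding p rect_def has_def shift_def by (simp add: add.commute)
  qed
  ultimately have "\<alpha> q = translate (x, y) (rect w h) q" for q
  proof (cases "q \<in> ?A")
    case True
    then obtain p where "p \<in> box w h" "q = shift (x, y) p" by blast
    then show ?thesis using \<open>\<And>p. p \<in> box w h \<Longrightarrow> \<alpha> (shift (x, y) p) = rect w h p\<close> by simp
  next
    case False
    then have "q \<notin> dom \<alpha>" "q \<notin> dom (translate (x, y) (rect w h))"
      using \<open>?A = dom \<alpha>\<close> dom_translate[of "(x, y)" "rect w h"] unfolding dom_rect by simp_all
    then show ?thesis unfolding domIff not_not by simp
  qed
  then have "\<alpha> = translate (x, y) (rect w h)" by blast
  moreover have "2 \<le> w" "2 \<le> h" using ab unfolding wh by auto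
  ultimately show ?thesis using that by blast
qed

section \<open>The temperature function and the instability of other rectangles\<close>

text \<open>Counting the numbers \<open>s\<close> below both \<open>k\<close> and 2 sqrt n avoids
  roots and turns monotonicity into set inclusion. The value \<open>8 * n + k + 3\<close> lies above
  \<open>k + 2\<close>, the largest value of the last branch, which keeps the function
  nondecreasing, and above \<open>n + 2\<close>, which bounds the cost of the halving cuts compared
  with it.\<close>

definition temp :: "nat \<Rightarrow> nat \<Rightarrow> nat" where
  "temp k n = (if n \<le> 1 then 1 else if k * k < 2 * n then 8 * n + k + 3
     else card {s. s < k \<and> s * s < 4 * n} + 2)"

lemma card_temp_le: "card {s. s < k \<and> s * s < 4 * (n::nat)} \<le> k"
  using card_mono[of "{..<k}" "{s. s < k \<and> s * s < 4 * n}"] by auto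

lemma mono_temp: "mono (temp k)"
proof (rule monoI)
  fix m n :: nat assume "m \<le> n"
  then have "card {s. s < k \<and> s * s < 4 * m} \<le> card {s. s < k \<and> s * s < 4 * n}"
    by (intro card_mono) auto
  then show "temp k m \<le> temp k n"
    using \<open>m \<le> n\<close> card_temp_le[of k m] unfolding temp_def by auto
qed

lemma temp_ge_1: "1 \<le> temp k n" and temp_1: "temp k 1 = 1"
  unfolding temp_def by auto

text \<open>The counted set is downward closed, so a member \<open>s\<close> brings in all
  \<open>s + 1\<close> numbers up to \<open>s\<close>.\<close>

lemma temp_gt:
  assumes "2 \<le> n" "s < k" "s * s < 4 * n"
  shows "s + 2 < temp k n"
proof -
  have "{..s} \<subseteq> {s. s < k \<and> s * s < 4 * n}"
  proof
    fix t assume "t \<in> {..s}"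
    then show "t \<in> {s. s < k \<and> s * s < 4 * n}" using assms mult_le_mono[of t s t s] by auto
  qed
  then have "card {..s} \<le> card {s. s < k \<and> s * s < 4 * n}" by (intro card_mono) auto
  then show ?thesis using assms unfolding temp_def by auto
qed

lemma temp_gt_large: "2 \<le> n \<Longrightarrow> k * k < 2 * n \<Longrightarrow> s \<le> n \<Longrightarrow> s + 2 < temp k n"
  unfolding temp_def by auto

lemma temp_ge_5: "3 \<le> k \<Longrightarrow> 2 \<le> n \<Longrightarrow> 5 \<le> temp k n"
  using temp_gt[of n 2 k] by simp

text \<open>Rounding in \<open>h div 2\<close> is harmless: \<open>w < 4 * (h div 2)\<close> still
  holds for \<open>2 \<le> h\<close> and \<open>w \<le> h\<close>, which gives
  \<open>w * w < 4 * n\<close> for the half of area \<open>n\<close>.\<close>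

lemma nonsquare_temp_aux:
  assumes "2 \<le> w" "w \<le> h" "w < k"
  shows "w + 2 < temp k (w * (h div 2))"
proof -
  have "w < 4 * (h div 2)" "1 \<le> h div 2" using assms by presburger+
  then have "w * w < w * (4 * (h div 2))" "2 * 1 \<le> w * (h div 2)"
    using assms by (simp, intro mult_le_mono) auto
  then show ?thesis using temp_gt[of "w * (h div 2)" w k] assms by (simp add: mult.left_commute)
qed

text \<open>The side to be halved depends on the parity of \<open>k\<close>, so that rounding loses
  nothing. For odd \<open>k\<close> the number \<open>k + 1 \<le> h\<close> is even; for even
  \<open>k\<close> the number \<open>k \<le> w\<close> is. In both cases twice the half has area at
  least \<open>k * (k + 1)\<close>.\<close>

lemma half_area_large:
  fixes k w h :: nat
  assumes "k \<le> w" "k < h" "2 \<le> k"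
  shows "k * k < 2 * (if odd k then w * (h div 2) else h * (w div 2))"
proof (cases "odd k")
  case True
  then have "k + 1 \<le> 2 * (h div 2)" using assms by presburger
  then have "k * (k + 1) \<le> w * (2 * (h div 2))" using assms by (intro mult_le_mono) auto
  then show ?thesis using True assms by (simp add: algebra_simps)
next
  case False
  then have "k \<le> 2 * (w div 2)" using assms by presburger
  then have "(k + 1) * k \<le> h * (2 * (w div 2))" using assms by (intro mult_le_mono) auto
  then show ?thesis using False assms by (simp add: algebra_simps)
qed

lemma nonsquare_temp:
  assumes "2 \<le> w" "2 \<le> h" "\<not> (w = k \<and> h = k)" "2 \<le> k"
  shows "w + 2 < temp k (w * (h div 2)) \<or> h + 2 < temp k (h * (w div 2))"
proof -
  have half: "1 \<le> h div 2" "1 \<le> w div 2" using assms by auto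
  then have ge: "w \<le> w * (h div 2)" "h \<le> h * (w div 2)" by auto
  have big: "w + 2 < temp k (w * (h div 2))" if "k * k < 2 * (w * (h div 2))"
    using that ge order_trans[OF assms(1) ge(1)] by (intro temp_gt_large) auto
  have big': "h + 2 < temp k (h * (w div 2))" if "k * k < 2 * (h * (w div 2))"
    using that ge order_trans[OF assms(2) ge(2)] by (intro temp_gt_large) auto
  consider "w \<le> h" "w < k" | "h \<le> w" "h < k" | "k \<le> w" "k < h" | "k \<le> h" "k < w"
    using assms(3) by linarith
  then show ?thesis
  proof cases
    case 1
    then show ?thesis using nonsquare_temp_aux assms by blast
  next
    case 2
    then show ?thesis using nonsquare_temp_aux assms by blast
  next
    case 3
    then show ?thesis using half_area_large[OF 3 assms(4)] big big' by (auto split: if_splits)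
  next
    case 4
    then show ?thesis using half_area_large[OF 4 assms(4)] big big' by (auto split: if_splits)
  qed
qed

lemma nonsquare_breaks:
  assumes "2 \<le> w" "2 \<le> h" "\<not> (w = k \<and> h = k)" "2 \<le> k" "same_supertile \<alpha> (rect w h)"
  shows "\<exists>\<beta>1 \<beta>2. breaks gs (temp k) \<alpha> \<beta>1 \<beta>2"
  using nonsquare_temp[OF assms(1-4)]
proof
  assume *: "w + 2 < temp k (w * (h div 2))"
  \<comment> \<open>Rounding down makes the first part the smaller one, with exactly the area to
    which \<open>nonsquare_temp\<close> refers.\<close>
  define s where s: "s = h div 2"
  then have sh: "0 < s" "s < h" "s \<le> h - s" using assms by auto
  let ?A = "{0..<int w} \<times> {0..<int s}" and ?B = "{0..<int w} \<times> {int s..<int h}"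
  have "nat (int h - int s) = h - s" by linarith
  then have "min (card ?A) (card ?B) = w * s" using sh by (simp add: min_absorb1)
  then have lt: "cut_str gs (rect w h) ?A ?B < temp k (min (card ?A) (card ?B))"
    using * s rect_horizontal_cut[OF assms(1) sh(1,2)] by simp
  have "breaks gs (temp k) \<alpha> (rect w h |` ?A) (rect w h |` ?B)"
    by (rule breaksI[where A = ?A and B = ?B])
      (use assms sh lt in \<open>auto simp: dom_rect box_def intro!: linked_subrect\<close>)
  then show ?thesis by blast
next
  assume *: "h + 2 < temp k (h * (w div 2))"
  define s where s: "s = w div 2"
  then have sh: "0 < s" "s < w" "s \<le> w - s" using assms by auto
  let ?A = "{0..<int s} \<times> {0..<int h}" and ?B = "{int s..<int w} \<times> {0..<int h}"
  have "nat (int w - int s) = w - s" by linarith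
  then have "min (card ?A) (card ?B) = h * s" using sh by (simp add: min_absorb1 mult.commute)
  then have lt: "cut_str gs (rect w h) ?A ?B < temp k (min (card ?A) (card ?B))"
    using * s rect_vertical_cut[OF assms(2) sh(1,2)] by simp
  have "breaks gs (temp k) \<alpha> (rect w h |` ?A) (rect w h |` ?B)"
    by (rule breaksI[where A = ?A and B = ?B])
      (use assms sh lt in \<open>auto simp: dom_rect box_def intro!: linked_subrect\<close>)
  then show ?thesis by blast
qed

lemma terminal_closed_asm:
  assumes "terminal tiles gs (temp k) \<alpha>" "3 \<le> k"
  shows "closed_asm \<alpha>"
proof
  show wf: "wf_asm tiles gs \<alpha>"
    using assms(1) producible_wf[of tiles gs "temp k" \<alpha>] temp_ge_1 unfolding terminal_def by blast
  show "q \<in> dom \<alpha>" if "p \<in> dom \<alpha>" "t \<in> tiles" "0 < bond_str gs (\<alpha>(q \<mapsto> t)) p q" for p q t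
  proof (rule ccontr)
    assume "q \<notin> dom \<alpha>"
    then have "combines gs (temp k) \<alpha> (Map.empty((0, 0) \<mapsto> t)) (\<alpha>(q \<mapsto> t))"
      using combines_single that wf temp_1 unfolding wf_asm_def by simp
    then show False using assms(1) producible.single[OF that(2)] unfolding terminal_def by blast
  qed
  show "5 \<le> cut_str gs \<alpha> A B"
    if "A \<union> B = dom \<alpha>" "A \<inter> B = {}" "2 \<le> card A" "2 \<le> card B" "linked gs \<alpha> A" "linked gs \<alpha> B" for A B
  proof (rule ccontr)
    assume "\<not> ?thesis"
    moreover have "5 \<le> temp k (min (card A) (card B))" using temp_ge_5 that assms(2) by simp
    moreover have "A \<noteq> {}" "B \<noteq> {}" using that by auto
    ultimately have "breaks gs (temp k) \<alpha> (\<alpha> |` A) (\<alpha> |` B)"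
      using that by (intro breaksI same_supertile_refl) auto
    then show False using assms(1) unfolding terminal_def by blast
  qed
qed

lemma terminal_is_square:
  assumes "terminal tiles gs (temp k) \<alpha>" "3 \<le> k"
  shows "same_supertile \<alpha> (rect k k)"
proof -
  interpret closed_asm \<alpha> using terminal_closed_asm[OF assms] .
  obtain x y w h where wh: "2 \<le> w" "2 \<le> h" "\<alpha> = translate (x, y) (rect w h)" by (rule eq_rect)
  then have "same_supertile \<alpha> (rect w h)"
    using same_supertile_sym same_supertile_translate by blast
  moreover have "w = k \<and> h = k"
  proof (rule ccontr)
    assume "\<not> ?thesis"
    then show False
      using nonsquare_breaks[OF wh(1,2), of k \<alpha>] calculation assms unfolding terminal_def by auto
  qed
  ultimately show ?thesis by simp
qed

section \<open>The isoperimetric bound for cuts of the square\<close>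

lemma int_crossing:
  fixes a b :: int
  assumes "a \<le> b" "P a" "\<not> P b"
  shows "\<exists>t. a \<le> t \<and> t < b \<and> P t \<and> \<not> P (t + 1)"
proof -
  have "\<not> P b \<longrightarrow> (\<exists>t. a \<le> t \<and> t < b \<and> P t \<and> \<not> P (t + 1))" using assms(1)
  proof (induction b rule: int_ge_induct)
    case base
    then show ?case using assms(2) by simp
  next
    case (step b)
    show ?case
    proof (cases "P b")
      case True
      then show ?thesis using step.hyps by auto
    next
      case False
      then obtain t where "a \<le> t" "t < b" "P t" "\<not> P (t + 1)" using step.IH by blast
      then show ?thesis by (intro impI exI[of _ t]) auto
    qed
  qed
  then show ?thesis using assms(3) by blast
qed

text \<open>A line of cells meeting both parts has two consecutive cells in different parts, and
  their bond crosses the cut.\<close>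

lemma line_cut_once:
  fixes f :: "int \<Rightarrow> pos"
  assumes "finite A" "finite B" and line: "\<And>t. 0 \<le> t \<Longrightarrow> t < n \<Longrightarrow> f t \<in> A \<union> B"
    and bond: "\<And>t. 0 \<le> t \<Longrightarrow> t + 1 < n \<Longrightarrow> g \<le> bond_str gs \<rho> (f t) (f (t + 1))"
    and ab: "0 \<le> a" "a < n" "f a \<in> A" "f a \<notin> B" "0 \<le> b" "b < n" "f b \<in> B" "f b \<notin> A"
  shows "g \<le> cut_str gs \<rho> A B"
proof (cases "a \<le> b")
  case True
  then obtain t where t: "a \<le> t" "t < b" "f t \<in> A" "f (t + 1) \<notin> A"
    using int_crossing[of a b "\<lambda>t. f t \<in> A"] ab by blast
  then have "f (t + 1) \<in> B" using line[of "t + 1"] ab by simp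
  then have "bond_str gs \<rho> (f t) (f (t + 1)) \<le> cut_str gs \<rho> A B"
    using t(3) bond_le_cut assms(1,2) by blast
  then show ?thesis using bond[of t] t ab by simp
next
  case False
  then obtain t where t: "b \<le> t" "t < a" "f t \<in> B" "f (t + 1) \<notin> B"
    using int_crossing[of b a "\<lambda>t. f t \<in> B"] ab by auto
  then have "f (t + 1) \<in> A" using line[of "t + 1"] ab by simp
  then have "bond_str gs \<rho> (f (t + 1)) (f t) \<le> cut_str gs \<rho> A B"
    using t(3) bond_le_cut assms(1,2) by blast
  then show ?thesis using bond[of t] t ab bond_str_sym[of gs \<rho> "f t"] by simp
qed

lemma line_cut_twice:
  fixes f :: "int \<Rightarrow> pos"
  assumes "finite A" "finite B" "A \<inter> B = {}" "inj f"
    and line: "\<And>t. 0 \<le> t \<Longrightarrow> t < n \<Longrightarrow> f t \<in> A \<union> B"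
    and bond: "\<And>t. 0 \<le> t \<Longrightarrow> t + 1 < n \<Longrightarrow> g \<le> bond_str gs \<rho> (f t) (f (t + 1))"
    and a: "0 \<le> a" "a < n" "f a \<in> A" and ends: "f 0 \<in> B" "f (n - 1) \<in> B"
  shows "2 * g \<le> cut_str gs \<rho> A B"
proof -
  obtain t where t: "0 \<le> t" "t < a" "f t \<in> B" "f (t + 1) \<notin> B"
    using int_crossing[of 0 a "\<lambda>t. f t \<in> B"] a ends assms(3) by auto
  obtain u where u: "a \<le> u" "u < n - 1" "f u \<in> A" "f (u + 1) \<notin> A"
    using int_crossing[of a "n - 1" "\<lambda>t. f t \<in> A"] a ends assms(3) by auto
  have in_t: "f (t + 1) \<in> A" using line[of "t + 1"] t a by simp
  have in_u: "f (u + 1) \<in> B" using line[of "u + 1"] u a by simp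
  let ?S = "{(f (t + 1), f t), (f u, f (u + 1))}"
  \<comment> \<open>The two crossing pairs may share their cell in \<open>A\<close>, when
    \<open>t + 1 = u\<close>; they are distinct because their cells in \<open>B\<close> lie on
    different sides of \<open>a\<close>.\<close>
  have "f t \<noteq> f (u + 1)" using assms(4) t u by (simp add: inj_eq)
  then have "(\<Sum>(p, q)\<in>?S. bond_str gs \<rho> p q)
      = bond_str gs \<rho> (f (t + 1)) (f t) + bond_str gs \<rho> (f u) (f (u + 1))" by simp
  moreover have "(\<Sum>(p, q)\<in>?S. bond_str gs \<rho> p q) \<le> cut_str gs \<rho> A B"
    unfolding cut_str_def using assms(1,2) in_t in_u t(3) u(3) by (intro sum_mono2) auto
  moreover have "g \<le> bond_str gs \<rho> (f (t + 1)) (f t)"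
    using bond[of t] t a bond_str_sym[of gs \<rho> "f t"] by simp
  moreover have "g \<le> bond_str gs \<rho> (f u) (f (u + 1))" using bond[of u] u a by simp
  ultimately show ?thesis by simp
qed

text \<open>Pairs in a common row and pairs in a common column are different pairs, since a pair of
  both kinds would be a single cell lying in \<open>A\<close> and in \<open>B\<close>.\<close>

lemma cut_str_rows_columns:
  assumes "finite I" "A \<subseteq> I \<times> I" "B \<subseteq> I \<times> I" "A \<inter> B = {}"
  shows "(\<Sum>y\<in>I. cut_str g \<rho> (A \<inter> UNIV \<times> {y}) (B \<inter> UNIV \<times> {y}))
    + (\<Sum>x\<in>I. cut_str g \<rho> (A \<inter> {x} \<times> UNIV) (B \<inter> {x} \<times> UNIV)) \<le> cut_str g \<rho> A B"
proof -
  let ?b = "\<lambda>(p, q). bond_str g \<rho> p q"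
  let ?H = "{r \<in> A \<times> B. snd (fst r) = snd (snd r)}" and ?V = "{r \<in> A \<times> B. fst (fst r) = fst (snd r)}"
  have fin: "finite A" "finite B" using assms finite_subset by blast+
  have "(A \<inter> UNIV \<times> {y}) \<times> (B \<inter> UNIV \<times> {y}) = {r \<in> ?H. snd (fst r) = y}" for y by auto
  then have H: "(\<Sum>y\<in>I. cut_str g \<rho> (A \<inter> UNIV \<times> {y}) (B \<inter> UNIV \<times> {y})) = sum ?b ?H"
    unfolding cut_str_def using assms fin by (simp only:) (intro sum.group; auto)
  have "(A \<inter> {x} \<times> UNIV) \<times> (B \<inter> {x} \<times> UNIV) = {r \<in> ?V. fst (fst r) = x}" for x by auto
  then have V: "(\<Sum>x\<in>I. cut_str g \<rho> (A \<inter> {x} \<times> UNIV) (B \<inter> {x} \<times> UNIV)) = sum ?b ?V"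
    unfolding cut_str_def using assms fin by (simp only:) (intro sum.group; auto)
  have "?H \<inter> ?V = {}" using assms(4) by auto
  then have "sum ?b ?H + sum ?b ?V = sum ?b (?H \<union> ?V)"
    using fin by (intro sum.union_disjoint[symmetric]) auto
  also have "\<dots> \<le> cut_str g \<rho> A B"
    unfolding cut_str_def using fin by (intro sum_mono2) auto
  finally show ?thesis using H V by simp
qed

text \<open>Separates the unit paid by every row or column that is met from the surplus
  \<open>e\<close> of a distinguished one, so that only the surpluses remain to be found.\<close>

lemma sum_excess:
  fixes f :: "'a \<Rightarrow> nat"
  assumes "finite S" "T \<subseteq> S" "\<And>y. y \<in> T \<Longrightarrow> 1 \<le> f y" "z \<in> T" "1 + e \<le> f z"
  shows "card T + e \<le> sum f S"
proof -
  have fT: "finite T" using assms finite_subset by blast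
  have "card T + e = (\<Sum>y\<in>T. 1 + (if y = z then e else 0))"
    using fT assms(4) by (simp only: sum.distrib) simp
  also have "\<dots> \<le> sum f T" using assms by (intro sum_mono) auto
  also have "\<dots> \<le> sum f S" using assms by (intro sum_mono2) auto
  finally show ?thesis .
qed

text \<open>If \<open>A\<close> meets \<open>r\<close> rows and \<open>c\<close> columns, it has at most \<open>r * c\<close> cells and its cut strength
  is at least \<open>r + c + 2\<close>; the summand 2 comes from the stronger border bonds when \<open>A\<close> touches the
  border, and otherwise from each met row and column being crossed twice.\<close>
lemma square_cut_avoiding:
  assumes k: "2 \<le> k" and AB: "A \<union> B = box k k" "A \<inter> B = {}" "A \<noteq> {}"
    and free: "\<And>x. 0 \<le> x \<Longrightarrow> x < int k \<Longrightarrow> (x, y0) \<in> B" "\<And>y. 0 \<le> y \<Longrightarrow> y < int k \<Longrightarrow> (x0, y) \<in> B"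
      "0 \<le> x0" "x0 < int k" "0 \<le> y0" "y0 < int k"
  shows "card {s. s < k \<and> s * s < 4 * card A} + 2 \<le> cut_str gs (rect k k) A B"
proof -
  let ?I = "{0..<int k}"
  define R where "R y = cut_str gs (rect k k) (A \<inter> UNIV \<times> {y}) (B \<inter> UNIV \<times> {y})" for y
  define C where "C x = cut_str gs (rect k k) (A \<inter> {x} \<times> UNIV) (B \<inter> {x} \<times> UNIV)" for x
  have sub: "A \<subseteq> ?I \<times> ?I" "B \<subseteq> ?I \<times> ?I" using AB(1) unfolding box_def by auto
  then have fin: "finite A" "finite B" using finite_subset by blast+
  have cover: "(x, y) \<in> A \<or> (x, y) \<in> B" if "0 \<le> x" "x < int k" "0 \<le> y" "y < int k" for x y
  proof -
    have "(x, y) \<in> box k k" using that by (simp add: box_def)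
    then show ?thesis unfolding AB(1)[symmetric] by blast
  qed
  have disj: "p \<notin> B" if "p \<in> A" for p using that AB(2) by blast
  have range: "0 \<le> x \<and> x < int k \<and> 0 \<le> y \<and> y < int k" if "(x, y) \<in> A" for x y
    using that sub by auto
  have total: "sum R ?I + sum C ?I \<le> cut_str gs (rect k k) A B"
    unfolding R_def C_def using cut_str_rows_columns[OF _ sub AB(2)] by simp
  \<comment> \<open>The row meets \<open>A\<close> in column \<open>x\<close> and \<open>B\<close>
    in the free column \<open>x0\<close>.\<close>
  have R1: "gs (code k y) \<le> R y" if "(x, y) \<in> A" for x y
    unfolding R_def
    by (rule line_cut_once[where f = "\<lambda>t. (t, y)" and n = "int k" and a = x and b = x0])
      (use range[OF that] that free disj cover fin rect_bond_right[of _ y k k] in \<open>auto simp: box_def\<close>)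
  have C1: "gs (code k x) \<le> C x" if "(x, y) \<in> A" for x y
    unfolding C_def
    by (rule line_cut_once[where f = "\<lambda>t. (x, t)" and n = "int k" and a = y and b = y0])
      (use range[OF that] that free disj cover fin rect_bond_up[of x _ k k] in \<open>auto simp: box_def\<close>)
  have R2: "2 * gs (code k y) \<le> R y" if "(x, y) \<in> A" "(0, y) \<in> B" "(int k - 1, y) \<in> B" for x y
    unfolding R_def
    by (rule line_cut_twice[where f = "\<lambda>t. (t, y)" and n = "int k" and a = x])
      (use range[OF that(1)] that disj cover fin rect_bond_right[of _ y k k] in \<open>auto simp: box_def inj_def\<close>)
  have C2: "2 * gs (code k x) \<le> C x" if "(x, y) \<in> A" "(x, 0) \<in> B" "(x, int k - 1) \<in> B" for x y
    unfolding C_def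
    by (rule line_cut_twice[where f = "\<lambda>t. (x, t)" and n = "int k" and a = y])
      (use range[OF that(1)] that disj cover fin rect_bond_up[of x _ k k] in \<open>auto simp: box_def inj_def\<close>)
  define Rs where "Rs = snd ` A"
  define Cs where "Cs = fst ` A"
  have Rs: "Rs \<subseteq> ?I" and Cs: "Cs \<subseteq> ?I"
    unfolding Rs_def Cs_def by (auto dest: range)
  have R_ge_1: "1 \<le> R y" if y: "y \<in> Rs" for y
  proof -
    obtain x where "(x, y) \<in> A" using y unfolding Rs_def by auto
    then show ?thesis using R1[of x y] gs_code_ge_1[of k y] by linarith
  qed
  have C_ge_1: "1 \<le> C x" if x: "x \<in> Cs" for x
  proof -
    obtain y where "(x, y) \<in> A" using x unfolding Cs_def by auto
    then show ?thesis using C1[of x y] gs_code_ge_1[of k x] by linarith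
  qed
  have excess: "card Rs + card Cs + d + e \<le> cut_str gs (rect k k) A B"
    if "y \<in> Rs" "1 + d \<le> R y" "x \<in> Cs" "1 + e \<le> C x" for x y d e
    using sum_excess[of ?I Rs R y d] sum_excess[of ?I Cs C x e] Rs Cs R_ge_1 C_ge_1 that total by simp
  have RsI: "y \<in> Rs" and CsI: "x \<in> Cs" if "(x, y) \<in> A" for x y
    using that unfolding Rs_def Cs_def by force+
  let ?E = "{0, int k - 1}"
  have gE: "gs (code k z) = 2" if "z \<in> ?E" for z using that k by (auto simp: code_def gs_def)
  obtain x y where xy: "(x, y) \<in> A" using AB(3) by auto
  have "card Rs + card Cs + 2 \<le> cut_str gs (rect k k) A B"
  proof (cases "\<exists>cx\<in>?E. \<exists>cy\<in>?E. (cx, cy) \<in> A")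
    case True
    then obtain cx cy where c: "cx \<in> ?E" "cy \<in> ?E" "(cx, cy) \<in> A" by blast
    \<comment> \<open>A corner cell lies on a border row and a border column, each crossed with
      strength 2, so each has surplus 1.\<close>
    then show ?thesis
      using excess[OF RsI[OF c(3)] _ CsI[OF c(3)], of 1 1] R1[OF c(3)] C1[OF c(3)] gE by simp
  next
    case False
    have corner: "(cx, cy) \<in> B" if "cx \<in> ?E" "cy \<in> ?E" for cx cy
      using False that cover[of cx cy] k by auto
    consider cx where "cx \<in> ?E" "(cx, y) \<in> A" | cy where "cy \<in> ?E" "(x, cy) \<in> A"
      | "\<And>c. c \<in> ?E \<Longrightarrow> (c, y) \<notin> A" "\<And>c. c \<in> ?E \<Longrightarrow> (x, c) \<notin> A" by blast
    then show ?thesis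
    proof cases
      case (1 cx)
      \<comment> \<open>Both ends of this border column are corners, hence in \<open>B\<close>. The
        column is crossed twice with strength 2, and its surplus 3 suffices alone.\<close>
      have "4 \<le> C cx" using C2[OF 1(2)] corner[OF 1(1)] gE[OF 1(1)] by simp
      then show ?thesis
        using excess[OF RsI[OF xy] _ CsI[OF 1(2)], of 0 3] R_ge_1[OF RsI[OF xy]] by simp
    next
      case (2 cy)
      have "4 \<le> R cy" using R2[OF 2(2)] corner[OF _ 2(1)] gE[OF 2(1)] by simp
      then show ?thesis
        using excess[OF RsI[OF 2(2)] _ CsI[OF xy], of 3 0] C_ge_1[OF CsI[OF xy]] by simp
    next
      case 3
      have ends: "(c, y) \<in> B" "(x, c) \<in> B" if "c \<in> ?E" for c
        using 3(1)[OF that] 3(2)[OF that] cover[of c y] cover[of x c] range[OF xy] that k by auto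
      \<comment> \<open>The row and the column of the chosen cell have all their ends in
        \<open>B\<close>, so both are crossed twice and have surplus 1 each.\<close>
      have "2 \<le> R y" using R2[OF xy] ends(1) gs_code_ge_1[of k y] by force
      moreover have "2 \<le> C x" using C2[OF xy] ends(2) gs_code_ge_1[of k x] by force
      ultimately show ?thesis using excess[OF RsI[OF xy] _ CsI[OF xy], of 1 1] by simp
    qed
  qed
  moreover have "card {s. s < k \<and> s * s < 4 * card A} \<le> card Rs + card Cs"
  proof -
    have "A \<subseteq> Cs \<times> Rs" unfolding Rs_def Cs_def by force
    then have "card A \<le> card Cs * card Rs"
      using card_mono[of "Cs \<times> Rs" A] fin unfolding Rs_def Cs_def by (simp add: card_cartesian_product)
    \<comment> \<open>The arithmetic-geometric mean inequality for the numbers of rows and columns: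
      every \<open>s\<close> with \<open>s * s < 4 * card A\<close> is below their sum.\<close>
    then have amgm: "4 * card A \<le> (card Rs + card Cs) * (card Rs + card Cs)"
    proof -
      have "4 * (card Cs * card Rs) \<le> (card Rs + card Cs) * (card Rs + card Cs)"
        using sum_squares_ge_zero[of "int (card Rs) - int (card Cs)" 0]
        by (subst of_nat_le_iff[where 'a = int, symmetric]) (simp add: algebra_simps)
      then show ?thesis using \<open>card A \<le> card Cs * card Rs\<close> by linarith
    qed
    have "{s. s < k \<and> s * s < 4 * card A} \<subseteq> {..<card Rs + card Cs}"
    proof
      fix s assume "s \<in> {s. s < k \<and> s * s < 4 * card A}"
      then have "s * s < (card Rs + card Cs) * (card Rs + card Cs)" using amgm by simp
      then show "s \<in> {..<card Rs + card Cs}" by (metis lessThan_iff mult_le_mono not_le)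
    qed
    then show ?thesis using card_mono[of "{..<card Rs + card Cs}"] by fastforce
  qed
  ultimately show ?thesis by simp
qed

lemma card_temp_mono:
  "m \<le> (n::nat) \<Longrightarrow> card {s. s < k \<and> s * s < 4 * m} \<le> card {s. s < k \<and> s * s < 4 * n}"
  by (intro card_mono) auto

text \<open>If all rows, or all columns, meet both parts, each of these \<open>k\<close> lines is
  crossed and the cost is at least \<open>k + 2\<close>. Otherwise some row and some column each lie
  in a single part; they share a cell, so it is the same part, and
  \<open>square_cut_avoiding\<close> applies to the other one.\<close>

lemma square_cut:
  assumes k: "2 \<le> k" and AB: "A \<union> B = box k k" "A \<inter> B = {}" "A \<noteq> {}" "B \<noteq> {}"
  shows "temp k (min (card A) (card B)) \<le> cut_str gs (rect k k) A B"
proof -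
  let ?I = "{0..<int k}" and ?n = "min (card A) (card B)"
  let ?c = "\<lambda>n. card {s. s < k \<and> s * s < 4 * (n::nat)}"
  define R where "R y = cut_str gs (rect k k) (A \<inter> UNIV \<times> {y}) (B \<inter> UNIV \<times> {y})" for y
  define C where "C x = cut_str gs (rect k k) (A \<inter> {x} \<times> UNIV) (B \<inter> {x} \<times> UNIV)" for x
  have sub: "A \<subseteq> ?I \<times> ?I" "B \<subseteq> ?I \<times> ?I" using AB(1) unfolding box_def by auto
  then have fin: "finite A" "finite B" using finite_subset by blast+
  have cover: "(x, y) \<in> A \<or> (x, y) \<in> B" if "0 \<le> x" "x < int k" "0 \<le> y" "y < int k" for x y
  proof -
    have "(x, y) \<in> box k k" using that by (simp add: box_def)
    then show ?thesis unfolding AB(1)[symmetric] by blast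
  qed
  have disj: "p \<notin> B" if "p \<in> A" for p using that AB(2) by blast
  have total: "sum R ?I + sum C ?I \<le> cut_str gs (rect k k) A B"
    unfolding R_def C_def using cut_str_rows_columns[OF _ sub AB(2)] by simp
  have main: "?c ?n + 2 \<le> cut_str gs (rect k k) A B"
  proof (cases "(\<forall>y\<in>?I. \<exists>a\<in>?I. \<exists>b\<in>?I. (a, y) \<in> A \<and> (b, y) \<in> B) \<or>
      (\<forall>x\<in>?I. \<exists>a\<in>?I. \<exists>b\<in>?I. (x, a) \<in> A \<and> (x, b) \<in> B)")
    case True
    have "k + 2 \<le> sum R ?I \<or> k + 2 \<le> sum C ?I"
      using True
    proof (elim disjE)
      assume *: "\<forall>y\<in>?I. \<exists>a\<in>?I. \<exists>b\<in>?I. (a, y) \<in> A \<and> (b, y) \<in> B"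
      have "gs (code k y) \<le> R y" if y: "y \<in> ?I" for y
      proof -
        obtain a b where ab: "a \<in> ?I" "b \<in> ?I" "(a, y) \<in> A" "(b, y) \<in> B" using * y by blast
        show ?thesis
          unfolding R_def
          by (rule line_cut_once[where f = "\<lambda>t. (t, y)" and n = "int k" and a = a and b = b])
            (use y ab disj cover fin rect_bond_right[of _ y k k] in \<open>auto simp: box_def\<close>)
      qed
      then show ?thesis using sum_mono[of ?I "\<lambda>y. gs (code k y)" R] sum_gs_code[OF k] by simp
    next
      assume *: "\<forall>x\<in>?I. \<exists>a\<in>?I. \<exists>b\<in>?I. (x, a) \<in> A \<and> (x, b) \<in> B"
      have "gs (code k x) \<le> C x" if x: "x \<in> ?I" for x
      proof -
        obtain a b where ab: "a \<in> ?I" "b \<in> ?I" "(x, a) \<in> A" "(x, b) \<in> B" using * x by blast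
        show ?thesis
          unfolding C_def
          by (rule line_cut_once[where f = "\<lambda>t. (x, t)" and n = "int k" and a = a and b = b])
            (use x ab disj cover fin rect_bond_up[of x _ k k] in \<open>auto simp: box_def\<close>)
      qed
      then show ?thesis using sum_mono[of ?I "\<lambda>x. gs (code k x)" C] sum_gs_code[OF k] by simp
    qed
    then show ?thesis using total card_temp_le[of k ?n] by linarith
  next
    case False
    then obtain x0 y0 where *: "x0 \<in> ?I" "y0 \<in> ?I"
      "\<And>a b. a \<in> ?I \<Longrightarrow> b \<in> ?I \<Longrightarrow> (a, y0) \<in> A \<Longrightarrow> (b, y0) \<notin> B"
      "\<And>a b. a \<in> ?I \<Longrightarrow> b \<in> ?I \<Longrightarrow> (x0, a) \<in> A \<Longrightarrow> (x0, b) \<notin> B" by blast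
    show ?thesis
    proof (cases "(x0, y0) \<in> A")
      case True
      have "(x, y0) \<in> A" "(x0, x) \<in> A" if "x \<in> ?I" for x
        using *(3)[of x0 x] *(4)[of y0 x] *(1,2) True that cover[of x y0] cover[of x0 x] by auto
      then have "?c (card B) + 2 \<le> cut_str gs (rect k k) B A"
        using square_cut_avoiding[of k B A y0 x0] k AB *(1,2) by (simp add: Un_commute Int_commute)
      then show ?thesis using card_temp_mono[of ?n "card B" k] cut_str_sym[of gs _ A B] by simp
    next
      case False
      have "(x, y0) \<in> B" "(x0, x) \<in> B" if "x \<in> ?I" for x
        using *(3)[of x x0] *(4)[of x y0] *(1,2) False that cover[of x y0] cover[of x0 x] cover[of x0 y0]
        by auto
      then have "?c (card A) + 2 \<le> cut_str gs (rect k k) A B"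
        using square_cut_avoiding[of k A B y0 x0] k AB *(1,2) by simp
      then show ?thesis using card_temp_mono[of ?n "card A" k] by simp
    qed
  qed
  have "card A + card B = k * k"
    using card_Un_disjoint[OF fin AB(2)] AB(1) unfolding box_def by simp
  \<comment> \<open>The smaller part has at most half of the cells, so the large branch of
    \<open>temp\<close> is never reached.\<close>
  then have "\<not> k * k < 2 * ?n" by linarith
  then show ?thesis using main unfolding temp_def by auto
qed

section \<open>Terminality of the square\<close>

lemma rect_no_break:
  assumes "2 \<le> k"
  shows "\<not> breaks gs (temp k) (rect k k) \<beta>1 \<beta>2"
proof
  assume "breaks gs (temp k) (rect k k) \<beta>1 \<beta>2"
  then obtain \<alpha>' \<beta>' v where *: "dom \<alpha>' \<inter> dom \<beta>' = {}" "dom \<alpha>' \<noteq> {}" "dom \<beta>' \<noteq> {}"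
    "\<alpha>' ++ \<beta>' = translate v (rect k k)"
    "cut_str gs (\<alpha>' ++ \<beta>') (dom \<alpha>') (dom \<beta>') < temp k (min (card (dom \<alpha>')) (card (dom \<beta>')))"
    unfolding breaks_def same_supertile_def by blast
  \<comment> \<open>Preimages carry the two parts back to the untranslated square, where
    \<open>square_cut\<close> applies.\<close>
  define A B where AB: "A = shift v -` dom \<alpha>'" "B = shift v -` dom \<beta>'"
  have surj: "surj (shift v)" by (metis shift_inverse surjI)
  then have img: "shift v ` A = dom \<alpha>'" "shift v ` B = dom \<beta>'" unfolding AB by simp_all
  have "dom \<alpha>' \<union> dom \<beta>' = shift v ` box k k"
    using *(4) dom_map_add[of \<alpha>' \<beta>'] dom_translate[of v "rect k k"] unfolding dom_rect by auto
  then have "A \<union> B = box k k"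
    unfolding AB using inj_vimage_image_eq[OF inj_shift] by (metis vimage_Un)
  moreover have "A \<inter> B = {}" using *(1) unfolding AB by blast
  moreover have "A \<noteq> {}" "B \<noteq> {}" using *(2,3) img image_empty by metis+
  ultimately have "temp k (min (card A) (card B)) \<le> cut_str gs (rect k k) A B"
    using square_cut assms by blast
  moreover have "card (dom \<alpha>') = card A" "card (dom \<beta>') = card B"
    unfolding img[symmetric] by (intro card_image inj_on_subset[OF inj_shift] subset_UNIV)+
  moreover have "cut_str gs (\<alpha>' ++ \<beta>') (dom \<alpha>') (dom \<beta>') = cut_str gs (rect k k) A B"
    unfolding *(4) img[symmetric] by (rule cut_str_translate)
  ultimately show False using *(5) by simp
qed

text \<open>All outer sides carry the null glue, so the cut towards any disjoint assembly has
  strength 0, whereas \<open>temp\<close> is positive.\<close>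

lemma rect_no_combination:
  assumes "2 \<le> k"
  shows "\<not> combines gs (temp k) (rect k k) \<beta> \<gamma>"
proof
  assume "combines gs (temp k) (rect k k) \<beta> \<gamma>"
  then obtain v \<beta>' where *: "dom (translate v (rect k k)) \<inter> dom \<beta>' = {}"
    "temp k (min (card (dom (translate v (rect k k)))) (card (dom \<beta>')))
      \<le> cut_str gs (translate v (rect k k) ++ \<beta>') (dom (translate v (rect k k))) (dom \<beta>')"
    unfolding combines_def same_supertile_def by blast
  let ?\<alpha> = "translate v (rect k k)"
  have "bond_str gs (?\<alpha> ++ \<beta>') p q = 0" if pq: "p \<in> dom ?\<alpha>" "q \<in> dom \<beta>'" for p q
  proof (rule ccontr)
    assume "bond_str gs (?\<alpha> ++ \<beta>') p q \<noteq> 0"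
    then have pos: "0 < bond_str gs (?\<alpha> ++ \<beta>') p q" by simp
    obtain x y where xy: "(x, y) \<in> box k k" "p = shift v (x, y)"
      using pq(1) unfolding dom_translate dom_rect by auto
    have p: "(?\<alpha> ++ \<beta>') p = Some (tile (code k x) (code k y))"
    proof -
      have "p \<notin> dom \<beta>'" using pq(1) *(1) by blast
      then have "(?\<alpha> ++ \<beta>') p = ?\<alpha> p" by (rule map_add_dom_app_simps(3))
      then show ?thesis using xy by (simp add: rect_def)
    qed
    have q: "q \<notin> shift v ` box k k" using pq(2) *(1) unfolding dom_translate dom_rect by blast
    obtain t where t: "(?\<alpha> ++ \<beta>') q = Some t" using pq(2) by auto
    have null: "glue_bond gs 0 g = 0" for g unfolding glue_bond_def gs_def by simp
    from q have out: "q = shift v (x', y') \<Longrightarrow> (x', y') \<notin> box k k" for x' y' by blast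
    have nb: "q \<in> {shift v (x + 1, y), shift v (x - 1, y), shift v (x, y + 1), shift v (x, y - 1)}"
      using bond_nbrs[OF pos] unfolding xy(2) nbrs_def shift_def by (simp add: algebra_simps)
    from nb consider (E) "q = shift v (x + 1, y)" | (W) "q = shift v (x - 1, y)"
      | (N) "q = shift v (x, y + 1)" | (S) "q = shift v (x, y - 1)" by blast
    then have "bond_str gs (?\<alpha> ++ \<beta>') p q = 0"
    proof cases
      case E
      have "code k x = 2" using out[OF E] xy(1) assms by (auto simp: box_def code_def)
      moreover have "bond_str gs (?\<alpha> ++ \<beta>') p q = glue_bond gs (gE (tile (code k x) (code k y))) (gW t)"
        using p t unfolding bond_str_def E xy(2) shift_def by simp
      ultimately show ?thesis by (simp add: tile_sides null)
    next
      case W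
      have "code k x = 1" using out[OF W] xy(1) assms by (auto simp: box_def code_def)
      moreover have "bond_str gs (?\<alpha> ++ \<beta>') p q = glue_bond gs (gW (tile (code k x) (code k y))) (gE t)"
        using p t unfolding bond_str_def W xy(2) shift_def by simp
      ultimately show ?thesis by (simp add: tile_sides null)
    next
      case N
      have "code k y = 2" using out[OF N] xy(1) assms by (auto simp: box_def code_def)
      moreover have "bond_str gs (?\<alpha> ++ \<beta>') p q = glue_bond gs (gN (tile (code k x) (code k y))) (gS t)"
        using p t unfolding bond_str_def N xy(2) shift_def by simp
      ultimately show ?thesis by (simp add: tile_sides null)
    next
      case S
      have "code k y = 1" using out[OF S] xy(1) assms by (auto simp: box_def code_def)
      moreover have "bond_str gs (?\<alpha> ++ \<beta>') p q = glue_bond gs (gS (tile (code k x) (code k y))) (gN t)"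
        using p t unfolding bond_str_def S xy(2) shift_def by simp
      ultimately show ?thesis by (simp add: tile_sides null)
    qed
    then show False using pos by simp
  qed
  then have "cut_str gs (?\<alpha> ++ \<beta>') (dom ?\<alpha>) (dom \<beta>') = 0"
    unfolding cut_str_def by (intro sum.neutral) auto
  then show False using *(2) temp_ge_1[of k "min (card (dom ?\<alpha>)) (card (dom \<beta>'))"] by simp
qed

theorem theorem3:
  shows "\<exists>(T :: tiletype set) (gstr :: glue \<Rightarrow> nat). finite T \<and>
     (\<forall>k :: nat. 7 \<le> k \<longrightarrow>
        (\<exists>\<tau> :: nat \<Rightarrow> nat. mono \<tau> \<and>
           (\<exists>P. is_square k P \<and> self_assembles T gstr \<tau> P)))"
proof (rule exI[of _ tiles], rule exI[of _ gs], intro conjI finite_tiles allI impI)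
  fix k :: nat assume "7 \<le> k"
  then have k: "3 \<le> k" "2 \<le> k" by simp_all
  \<comment> \<open>The unreduced bounds keep the syntactic shape of \<open>is_square\<close> with
    both offsets equal to 0.\<close>
  let ?P = "{0 + 1..0 + int k} \<times> {0 + 1..0 + int k}"
  have "producible tiles gs (temp k) (rect k k)"
    using linked_producible[OF wf_rect] k temp_1 by simp
  then have "terminal tiles gs (temp k) (rect k k)"
    unfolding terminal_def using rect_no_break rect_no_combination k by blast
  moreover have "\<exists>\<alpha>'. same_supertile \<alpha> \<alpha>' \<and> dom \<alpha>' = ?P" if "terminal tiles gs (temp k) \<alpha>" for \<alpha>
  proof (intro exI conjI)
    show "same_supertile \<alpha> (translate (1, 1) (rect k k))"
      using terminal_is_square[OF that k(1)] same_supertile_translate same_supertile_trans by blast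
    have "shift (1, 1) ` box k k = ?P"
    proof
      show "?P \<subseteq> shift (1, 1) ` box k k"
      proof
        fix p assume "p \<in> ?P"
        then show "p \<in> shift (1, 1) ` box k k"
          by (intro image_eqI[of _ _ "(fst p - 1, snd p - 1)"]) (auto simp: shift_def box_def)
      qed
    qed (auto simp: shift_def box_def)
    then show "dom (translate (1, 1) (rect k k)) = ?P" unfolding dom_translate dom_rect .
  qed
  ultimately have "self_assembles tiles gs (temp k) ?P" unfolding self_assembles_def by blast
  moreover have "is_square k ?P" unfolding is_square_def by blast
  ultimately show "\<exists>\<tau>. mono \<tau> \<and> (\<exists>P. is_square k P \<and> self_assembles tiles gs \<tau> P)"
    using mono_temp by blast
qed

end
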